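(* Let $n\ge1$ and $p$ be integers, let $1\le s\le S<\frac p2$ be integers, and let $X_1,\dots,X_n$ be i.i.d. centered Gaussian vectors in $\mathbb{R}^p$ with $\Sigma_n=\frac1n\sum_{k=1}^nX_kX_k^T$. For $u>0$ let $$t_{n,p}^{MS+}=\max\left\{\sqrt{\frac{u\cdot S}{n(p-S)}},\;\frac{2u\cdot S}{n(p-S)}\right\}$$ and define the test $$\Delta_n^{MS+}=I\left(\varphi_{A_{1:S}}(\Sigma_n-I_p)\ge t_{n,p}^{MS+}\right).$$ Then $$R(\Delta_n^{MS+},\mathcal{F}_+)\le 2\exp\left(-\frac u4\right),\qquad \mathcal{F}_+=\mathcal{F}_+(s,S,\sigma),$$ provided that $\sigma\ge\dfrac{2(s+1)}{s}\,t_{n,p}^{MS+}$.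
   Context: $I(\cdot)$ is the indicator function. $\mathbb{P}_\Sigma$ denotes probability when $X_1,\dots,X_n$ are i.i.d. $\mathcal{N}_p(0,\Sigma)$. For a symmetric $p\times p$ matrix $A$, $\varphi_A(B)=\mathrm{Tr}(AB)$. For $1\le j\le p-1$, $A_j$ is the $p\times p$ matrix with entries $[A_j]_{k\ell}=\frac{1}{2(p-j)}$ if $|k-\ell|=j$ and $0$ otherwise, and $A_{1:S}=\sum_{j=1}^SA_j$. $\mathcal{S}_p^{++}$ is the set of symmetric positive definite $p\times p$ matrices and $\mathcal{T}_p$ the set of $p\times p$ Toeplitz matrices; for $\Sigma\in\mathcal{S}_p^{++}\cap\mathcal{T}_p$ write $\Sigma_{ij}=\sigma_{|i-j|}$. Standing assumption: all covariance matrices satisfy $\sigma_0=1$ (correlation matrices). For a real $\sigma>0$, $\mathcal{F}_+(s,S,\sigma)$ is the set of $\Sigma\in\mathcal{S}_p^{++}\cap\mathcal{T}_p$ (with $\sigma_0=1$) for which there exists $\mathbf{S}\subseteq\{1,\dots,S\}$ with $|\mathbf{S}|=s$ such that $\sigma_j\ge\sigma$ for all $j\in\mathbf{S}$ and $\sigma_j=0$ for all $j\in\{1,\dots,p-1\}\setminus\mathbf{S}$. For a test $\Delta_n$ (a $\{0,1\}$-valued function of the observations) and a class $\mathcal{G}$ of covariance matrices, the maximal testing risk is $R(\Delta_n,\mathcal{G})=\mathbb{P}_{I_p}(\Delta_n=1)+\sup_{\Sigma\in\mathcal{G}}\mathbb{P}_\Sigma(\Delta_n=0)$ (a supremum over an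 empty class being $0$). *)

theory Defs
  imports "HOL-Probability.Probability"
begin

text \<open>
  The dimension \<open>p\<close> is \<open>CARD('p)\<close> for an index type \<open>'p\<close>. Toeplitz structure needs ordered
  indices, hence the sort \<open>{finite, wellorder}\<close>, that is, a finite linear order:
  \<open>idx\<close> is the order isomorphism from \<open>'p\<close> onto \<open>{0, ..., p - 1}\<close>. Starting at 0 instead of 1
  is immaterial, as only differences of indices are used.
\<close>

definition idx :: "'p::{finite,wellorder} \<Rightarrow> nat" where
  "idx i = card {k. k < i}"

definition lag :: "'p::{finite,wellorder} \<Rightarrow> 'p \<Rightarrow> nat" where
  "lag i j = nat \<bar>int (idx i) - int (idx j)\<bar>"

definition spd_matrices :: "(real^'p^'p) set" where
  "spd_matrices = {\<Sigma>. transpose \<Sigma> = \<Sigma> \<and> (\<forall>x. x \<noteq> 0 \<longrightarrow> 0 < x \<bullet> (\<Sigma> *v x))}"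

definition toeplitz_matrices :: "(real^'p::{finite,wellorder}^'p::_) set" where
  "toeplitz_matrices = {\<Sigma>. \<exists>a :: int \<Rightarrow> real. \<forall>i j. \<Sigma> $ i $ j = a (int (idx i) - int (idx j))}"

text \<open>
  The witness \<open>c\<close> is the sequence \<open>\<sigma>\<^sub>0, \<sigma>\<^sub>1, ...\<close> with \<open>\<Sigma>\<^sub>i\<^sub>j = \<sigma>\<^bsub>|i - j|\<^esub>\<close>; it exists for every
  symmetric Toeplitz matrix and \<open>\<Sigma>\<close> determines its values at \<open>0, ..., p - 1\<close>.
\<close>

definition F_plus :: "nat \<Rightarrow> nat \<Rightarrow> real \<Rightarrow> (real^'p::{finite,wellorder}^'p::_) set" where
  "F_plus s S \<sigma> =
    {\<Sigma> \<in> spd_matrices \<inter> toeplitz_matrices.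
      \<exists>c :: nat \<Rightarrow> real. (\<forall>i j. \<Sigma> $ i $ j = c (lag i j)) \<and> c 0 = 1 \<and>
        (\<exists>J \<subseteq> {1..S}. card J = s \<and> (\<forall>j\<in>J. \<sigma> \<le> c j) \<and> (\<forall>j\<in>{1..CARD('p) - 1} - J. c j = 0))}"

definition A_mat :: "nat \<Rightarrow> real^'p::{finite,wellorder}^'p::_" where
  "A_mat j = (\<chi> k l. if lag k l = j then 1 / (2 * (real CARD('p) - real j)) else 0)"

definition A_upto :: "nat \<Rightarrow> real^'p::{finite,wellorder}^'p::_" where
  "A_upto S = (\<Sum>j = 1..S. A_mat j)"

definition phi :: "real^'p^'p \<Rightarrow> real^'p^'p \<Rightarrow> real" where
  "phi A B = trace (A ** B)"

text \<open>
  The law \<open>N\<^sub>p(0, \<Sigma>)\<close> through its Lebesgue density; meaningful for positive definite \<open>\<Sigma>\<close>,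
  the only case used.
\<close>

definition centered_normal :: "real^'p^'p \<Rightarrow> (real^'p) measure" where
  "centered_normal \<Sigma> =
    density lborel (\<lambda>x. ennreal
      (exp (- (x \<bullet> (matrix_inv \<Sigma> *v x)) / 2) / sqrt ((2 * pi) ^ CARD('p) * det \<Sigma>)))"

text \<open>The joint law of the observations: \<open>X 1, ..., X n\<close> are i.i.d. with law \<open>N\<^sub>p(0, \<Sigma>)\<close>.\<close>

definition sample_law :: "nat \<Rightarrow> real^'p^'p \<Rightarrow> (nat \<Rightarrow> real^'p) measure" where
  "sample_law n \<Sigma> = (\<Pi>\<^sub>M k\<in>{1..n}. centered_normal \<Sigma>)"

definition sample_cov :: "nat \<Rightarrow> (nat \<Rightarrow> real^'p) \<Rightarrow> real^'p^'p" where
  "sample_cov n X = (1 / real n) *\<^sub>R (\<Sum>k = 1..n. \<chi> i j. X k $ i * X k $ j)"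

text \<open>
  Tests take their values in \<open>{0, 1}\<close>. Inserting 0 makes the supremum over an empty class 0
  and changes nothing otherwise, as probabilities are nonnegative.
\<close>

definition risk :: "nat \<Rightarrow> ((nat \<Rightarrow> real^'p) \<Rightarrow> nat) \<Rightarrow> (real^'p^'p) set \<Rightarrow> real" where
  "risk n \<Delta> G =
    measure (sample_law n (mat 1)) {X \<in> space (sample_law n (mat 1)). \<Delta> X = 1} +
    Sup (insert 0 ((\<lambda>\<Sigma>. measure (sample_law n \<Sigma>) {X \<in> space (sample_law n \<Sigma>). \<Delta> X = 0}) ` G))"

definition MS_threshold :: "nat \<Rightarrow> nat \<Rightarrow> nat \<Rightarrow> real \<Rightarrow> real" where
  "MS_threshold n p S u =
    max (sqrt (u * real S / (real n * (real p - real S))))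
        (2 * u * real S / (real n * (real p - real S)))"

definition MS_test :: "nat \<Rightarrow> nat \<Rightarrow> real \<Rightarrow> (nat \<Rightarrow> real^'p::{finite,wellorder}) \<Rightarrow> nat" where
  "MS_test n S u X =
    of_bool (MS_threshold n CARD('p) S u \<le> phi (A_upto S) (sample_cov n X - mat 1))"

end

theory Submission
  imports Defs
begin

text \<open>
  Since \<open>A\<^bsub>1:S\<^esub>\<close> has zero diagonal, the test statistic is \<open>n\<^sup>-\<^sup>1 \<Sum>\<^sub>k X\<^sub>k\<^sup>T A X\<^sub>k\<close> with \<open>A = A\<^bsub>1:S\<^esub>\<close>.
  Factor \<open>\<Sigma> = T T\<^sup>T\<close> so that \<open>T\<^sup>T A T\<close> is diagonal with entries \<open>d\<^sub>i\<close>; then \<open>X\<^sub>k\<^sup>T A X\<^sub>k\<close> has the law of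
  \<open>\<Sum>\<^sub>i d\<^sub>i Z\<^sub>i\<^sup>2\<close> with standard normal \<open>Z\<^sub>i\<close>, and the Chernoff bound shows that the statistic exceeds
  its mean \<open>tr (A \<Sigma>)\<close> by \<open>K (2 \<surd>(V y) + 2 a y)\<close> with probability at most \<open>exp (- n y)\<close>, where \<open>K\<close> and \<open>a\<close>
  bound the operator norms of \<open>\<Sigma>\<close> and \<open>A\<close>, and \<open>V\<close> bounds the squared Frobenius norm of \<open>A\<close>;
  replacing \<open>A\<close> by \<open>- A\<close> gives the lower tail.
  For \<open>y = u / (4 n)\<close> the bracket is at most the threshold \<open>t\<close>, which settles the type I error
  (\<open>K = 1\<close>). On the alternative the mean is \<open>m = \<Sum>\<^sub>j \<sigma>\<^sub>j \<ge> s \<sigma>\<close>, and \<open>K = 1 + 2 m\<close> is admissible. Positive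
  definiteness forces \<open>\<sigma> < 1\<close>, hence \<open>t < s / (2 (s + 1))\<close>, and this gives \<open>m - t \<ge> (1 + 2 m) t\<close>.
\<close>

subsection \<open>Simultaneous diagonalization\<close>

text \<open>For small t of the sign of a the linear term dominates the quadratic one. At t = a / c
  the value is a^2 (c + b) / c^2, which is positive for c > |b|. This serves as the first-order
  condition at a maximum.\<close>

lemma linear_coeff_zero_if_nonpos:
  fixes a b :: real
  assumes "\<And>t. a * t + b * t\<^sup>2 \<le> 0"
  shows "a = 0"
proof (rule ccontr)
  assume "a \<noteq> 0"
  define c where "c = \<bar>b\<bar> + 1"
  have c: "c > 0" "c + b > 0" unfolding c_def by auto
  have "a * (a / c) + b * (a / c)\<^sup>2 = a\<^sup>2 * (c + b) / c\<^sup>2"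
    using c(1) by (simp add: field_simps power2_eq_square)
  moreover have "a\<^sup>2 * (c + b) / c\<^sup>2 > 0"
    using c \<open>a \<noteq> 0\<close> by simp
  ultimately show False
    using assms[of "a / c"] by linarith
qed

lemma symmetric_matrix_inner:
  fixes A :: "real^'n^'n"
  assumes "transpose A = A"
  shows "x \<bullet> (A *v y) = (A *v x) \<bullet> y"
  by (metis assms dot_lmul_matrix transpose_matrix_vector)

text \<open>The quadratic form attains its maximum l over the unit sphere of W at some v. The
  residual r = A v - l v lies in W, and moving v along r changes the form minus l times the squared
  norm to first order by 2 (r . r), so r = 0.\<close>

lemma symmetric_eigenvector_in_invariant_subspace:
  fixes A :: "real^'n^'n"
  assumes sym: "transpose A = A"
    and W: "subspace W" and inv: "\<And>x. x \<in> W \<Longrightarrow> A *v x \<in> W"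
    and "w \<in> W" "w \<noteq> 0"
  obtains v l where "v \<in> W" "norm v = 1" "A *v v = l *\<^sub>R v"
proof -
  let ?q = "\<lambda>x. x \<bullet> (A *v x)"
  have "compact (sphere 0 1 \<inter> W)"
    by (intro compact_Int_closed compact_sphere closed_subspace W)
  moreover have "(1 / norm w) *\<^sub>R w \<in> sphere 0 1 \<inter> W"
    using assms by (auto simp: subspace_scale)
  moreover have "continuous_on (sphere 0 1 \<inter> W) ?q"
    by (intro continuous_intros linear_continuous_on matrix_vector_mul_bounded_linear)
  ultimately obtain v where v: "v \<in> sphere 0 1 \<inter> W"
    and max: "\<And>x. x \<in> sphere 0 1 \<inter> W \<Longrightarrow> ?q x \<le> ?q v"
    using continuous_attains_sup[of "sphere 0 1 \<inter> W" ?q] by blast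
  \<comment> \<open>By homogeneity the maximum bounds the form on all of W, so the perturbed vector
    below need not be normalized.\<close>
  have max': "?q x \<le> ?q v * (x \<bullet> x)" if "x \<in> W" for x
  proof (cases "x = 0")
    case False
    have "(1 / norm x) *\<^sub>R x \<in> sphere 0 1 \<inter> W"
      using False that W by (auto simp: subspace_scale)
    from max[OF this] have "?q x / (norm x)\<^sup>2 \<le> ?q v"
      by (simp add: matrix_vector_mult_scaleR power2_eq_square)
    then show ?thesis
      using False by (simp add: divide_le_eq power2_norm_eq_inner)
  qed simp
  define l where "l = ?q v"
  define r where "r = A *v v - l *\<^sub>R v"
  have vW: "v \<in> W" and v1: "v \<bullet> v = 1"
    using v by (auto simp: norm_eq_1)
  have rW: "r \<in> W"
    unfolding r_def using vW W inv by (simp add: subspace_diff subspace_scale)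
  have "2 * (r \<bullet> r) = 0"
  proof (rule linear_coeff_zero_if_nonpos)
    fix t :: real
    have "v + t *\<^sub>R r \<in> W"
      using vW rW W by (simp add: subspace_add subspace_scale)
    from max'[OF this] have le: "?q (v + t *\<^sub>R r) \<le> l * ((v + t *\<^sub>R r) \<bullet> (v + t *\<^sub>R r))"
      unfolding l_def .
    have "v \<bullet> (A *v r) = r \<bullet> (A *v v)"
      using symmetric_matrix_inner[OF sym, of v r] by (simp add: inner_commute)
    then have q: "?q (v + t *\<^sub>R r) = l + 2 * t * (r \<bullet> (A *v v)) + t\<^sup>2 * ?q r"
      by (simp add: matrix_vector_right_distrib matrix_vector_mult_scaleR inner_add_left
          inner_add_right l_def power2_eq_square algebra_simps)
    have n: "(v + t *\<^sub>R r) \<bullet> (v + t *\<^sub>R r) = 1 + 2 * t * (r \<bullet> v) + t\<^sup>2 * (r \<bullet> r)"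
      using v1 by (simp add: inner_add_left inner_add_right inner_commute power2_eq_square algebra_simps)
    have rr: "r \<bullet> r = r \<bullet> (A *v v) - l * (r \<bullet> v)"
      by (subst (2) r_def) (simp add: inner_diff_right)
    show "2 * (r \<bullet> r) * t + (?q r - l * (r \<bullet> r)) * t\<^sup>2 \<le> 0"
      using le unfolding q n by (subst rr) (simp add: algebra_simps)
  qed
  then have "A *v v = l *\<^sub>R v"
    by (simp add: r_def)
  then show thesis
    using that vW v1 by (auto simp: norm_eq_1)
qed

text \<open>Take an orthonormal set of eigenvectors of maximal size. If it did not span, its
  orthogonal complement would be nonzero and, by symmetry, invariant under A, so it would contain a
  further eigenvector.\<close>

lemma symmetric_orthonormal_eigenbasis:
  fixes A :: "real^'n^'n"
  assumes sym: "transpose A = A"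
  obtains B where "pairwise orthogonal B" "\<And>v. v \<in> B \<Longrightarrow> norm v = 1"
    "\<And>v. v \<in> B \<Longrightarrow> \<exists>l. A *v v = l *\<^sub>R v" "finite B" "card B = CARD('n)"
proof -
  define P where "P B \<longleftrightarrow> pairwise orthogonal B \<and> (\<forall>v\<in>B. norm v = 1 \<and> (\<exists>l. A *v v = l *\<^sub>R v))" for B
  have P: "independent B \<and> finite B \<and> card B \<le> CARD('n)" if "P B" for B
  proof -
    have "independent B"
      using that unfolding P_def by (intro pairwise_orthogonal_independent) auto
    with independent_bound[of B] show ?thesis
      by simp
  qed
  have "P {}" by (simp add: P_def)
  then obtain B where B: "P B" and Bmax: "\<And>B'. P B' \<Longrightarrow> card B' \<le> card B"
    using ex_has_greatest_nat[of P "{}" card "CARD('n) + 1"] P by (auto simp: less_Suc_eq_le)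
  have "card B = CARD('n)"
  proof (rule ccontr)
    assume "card B \<noteq> CARD('n)"
    then have "card B < CARD('n)"
      using P[OF B] by linarith
    then have "dim (span B) < DIM(real^'n)"
      using dim_eq_card_independent[of B] P[OF B] by simp
    then obtain w where w: "w \<noteq> 0" "\<And>y. y \<in> span B \<Longrightarrow> orthogonal w y"
      using orthogonal_to_subspace_exists[of "span B"] by (auto simp: span_span)
    define W where "W = {x. \<forall>y\<in>B. y \<bullet> x = 0}"
    have "subspace W"
      unfolding W_def subspace_def by (auto simp: inner_add_right)
    moreover have "A *v x \<in> W" if "x \<in> W" for x
    proof -
      have "y \<bullet> (A *v x) = 0" if y: "y \<in> B" for y
      proof -
        obtain l where "A *v y = l *\<^sub>R y"
          using B y by (auto simp: P_def)
        then show ?thesis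
          using \<open>x \<in> W\<close> y by (simp add: symmetric_matrix_inner[OF sym] W_def)
      qed
      then show ?thesis by (simp add: W_def)
    qed
    moreover have "w \<in> W"
      using w(2) by (auto simp: W_def orthogonal_def inner_commute span_base)
    ultimately obtain v l where v: "v \<in> W" "norm v = 1" "A *v v = l *\<^sub>R v"
      using symmetric_eigenvector_in_invariant_subspace[OF sym] w(1) by metis
    have "P (insert v B)"
      using B v unfolding P_def W_def pairwise_insert orthogonal_def by (auto simp: inner_commute)
    moreover have "v \<notin> B"
      using v by (auto simp: W_def norm_eq_1)
    ultimately show False
      using Bmax[of "insert v B"] P[OF B] by simp
  qed
  then show thesis
    using that[of B] B P[OF B] by (auto simp: P_def)
qed

definition diag_mat :: "('n \<Rightarrow> real) \<Rightarrow> real^'n^'n" where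
  "diag_mat d = (\<chi> i j. if i = j then d i else 0)"

lemma matrix_conj_entry:
  fixes A :: "real^'n^'n" and T :: "real^'n^'n"
  shows "(transpose T ** A ** T) $ i $ j = column i T \<bullet> (A *v column j T)"
proof -
  have "(transpose T ** A ** T) $ i $ j = (transpose T ** (A ** T)) $ i $ j"
    by (simp add: matrix_mul_assoc)
  also have "\<dots> = column i T \<bullet> column j (A ** T)"
    by (simp add: matrix_matrix_mult_def transpose_def column_def inner_vec_def)
  also have "column j (A ** T) = A *v column j T"
    by (simp add: column_def matrix_matrix_mult_def matrix_vector_mult_def vec_eq_iff)
  finally show ?thesis .
qed

lemma symmetric_matrix_diagonalizable:
  fixes A :: "real^'n^'n"
  assumes sym: "transpose A = A"
  obtains Q :: "real^'n^'n" and d where "orthogonal_matrix Q" "transpose Q ** A ** Q = diag_mat d"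
proof -
  obtain B where B: "pairwise orthogonal B" "\<And>v. v \<in> B \<Longrightarrow> norm v = 1"
    "\<And>v. v \<in> B \<Longrightarrow> \<exists>l. A *v v = l *\<^sub>R v" "finite B" "card B = CARD('n)"
    using symmetric_orthonormal_eigenbasis[OF sym] by metis
  obtain f :: "'n \<Rightarrow> real^'n" where f: "bij_betw f UNIV B"
    using B(4,5) by (metis finite_same_card_bij finite)
  define Q where "Q = transpose (\<chi> i. f i)"
  have col: "column i Q = f i" for i
    by (simp add: Q_def column_def transpose_def vec_eq_iff)
  have fB: "f i \<in> B" for i
    using f by (auto simp: bij_betw_def)
  have inj: "f i = f j \<longleftrightarrow> i = j" for i j
    using f by (auto simp: bij_betw_def inj_on_def)
  have ip: "f i \<bullet> f j = (if i = j then 1 else 0)" for i j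
    using B(1) B(2)[OF fB] fB inj[of i j]
    by (auto simp: norm_eq_1 pairwise_def orthogonal_def)
  obtain l where l: "\<And>v. v \<in> B \<Longrightarrow> A *v v = l v *\<^sub>R v"
    using B(3) by metis
  \<comment> \<open>With the identity as middle factor, \<open>matrix_conj_entry\<close> gives the
    inner products of the columns, so orthonormality becomes orthogonality of Q.\<close>
  have "transpose Q ** mat 1 ** Q = mat 1"
    unfolding vec_eq_iff matrix_conj_entry by (simp add: col ip) (simp add: mat_def)
  then have "orthogonal_matrix Q"
    by (simp add: orthogonal_matrix)
  moreover have "transpose Q ** A ** Q = diag_mat (\<lambda>i. l (f i))"
    by (simp add: vec_eq_iff matrix_conj_entry col l[OF fB] ip diag_mat_def)
  ultimately show thesis using that by blast
qed

lemma diag_mat_mult: "diag_mat a ** diag_mat b = diag_mat (\<lambda>i. a i * b i)"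
  by (auto simp: diag_mat_def matrix_matrix_mult_def vec_eq_iff mult_delta_left mult_delta_right)

lemma transpose_diag_mat [simp]: "transpose (diag_mat d) = diag_mat d"
  by (auto simp: diag_mat_def transpose_def vec_eq_iff)

text \<open>If Q diagonalizes the matrix with eigenvalues \<open>d i\<close>, the factor is Q times
  the diagonal matrix of the square roots of \<open>d i\<close>. These are nonnegative as values of
  the quadratic form.\<close>

lemma spd_factorization:
  fixes \<Sigma> :: "real^'n^'n"
  assumes "\<Sigma> \<in> spd_matrices"
  obtains L :: "real^'n^'n" where "\<Sigma> = L ** transpose L"
proof -
  obtain Q d where Q: "orthogonal_matrix Q" and d: "transpose Q ** \<Sigma> ** Q = diag_mat d"
    using symmetric_matrix_diagonalizable assms by (auto simp: spd_matrices_def)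
  have dpos: "0 \<le> d i" for i
  proof -
    have "d i = column i Q \<bullet> (\<Sigma> *v column i Q)"
      using arg_cong[OF d, of "\<lambda>M. M $ i $ i"] by (simp add: matrix_conj_entry diag_mat_def)
    then show ?thesis
      using assms by (cases "column i Q = 0") (auto simp: spd_matrices_def intro: less_imp_le)
  qed
  let ?R = "diag_mat (\<lambda>i. sqrt (d i))"
  have R: "?R ** ?R = diag_mat d"
    using dpos by (simp add: diag_mat_mult)
  have QQ: "Q ** transpose Q = mat 1"
    using Q by (simp add: orthogonal_matrix_def)
  have "\<Sigma> = (Q ** transpose Q) ** \<Sigma> ** (Q ** transpose Q)"
    by (simp add: QQ)
  also have "\<dots> = Q ** (transpose Q ** \<Sigma> ** Q) ** transpose Q"
    by (simp only: matrix_mul_assoc)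
  also have "\<dots> = (Q ** ?R) ** transpose (Q ** ?R)"
    by (simp only: d R[symmetric] matrix_transpose_mul transpose_diag_mat matrix_mul_assoc)
  finally show thesis by (rule that)
qed

text \<open>For every orthogonal Q, L Q is again a factor of \<Sigma>. This freedom is spent on
  diagonalizing the symmetric matrix L^T A L.\<close>

lemma simultaneous_diagonalization:
  fixes \<Sigma> A :: "real^'n^'n"
  assumes "\<Sigma> \<in> spd_matrices" and sym: "transpose A = A"
  obtains T :: "real^'n^'n" and d where "\<Sigma> = T ** transpose T" "transpose T ** A ** T = diag_mat d"
proof -
  obtain L :: "real^'n^'n" where L: "\<Sigma> = L ** transpose L"
    using spd_factorization assms(1) by blast
  have "transpose (transpose L ** A ** L) = transpose L ** A ** L"
    by (simp add: matrix_transpose_mul sym matrix_mul_assoc)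
  then obtain Q d where Q: "orthogonal_matrix Q"
    and d: "transpose Q ** (transpose L ** A ** L) ** Q = diag_mat d"
    using symmetric_matrix_diagonalizable by metis
  show thesis
  proof (rule that)
    have "L ** (Q ** transpose Q) ** transpose L = \<Sigma>"
      using Q L by (simp add: orthogonal_matrix_def)
    then show "\<Sigma> = (L ** Q) ** transpose (L ** Q)"
      by (simp only: matrix_transpose_mul matrix_mul_assoc)
    show "transpose (L ** Q) ** A ** (L ** Q) = diag_mat d"
      using d by (simp only: matrix_transpose_mul matrix_mul_assoc)
  qed
qed

section \<open>Frobenius norms and bounds on the diagonalized form\<close>

lemma norm_matrix_squared:
  fixes M :: "real^'n^'n"
  shows "(norm M)\<^sup>2 = (\<Sum>i\<in>UNIV. \<Sum>j\<in>UNIV. (M $ i $ j)\<^sup>2)"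
  unfolding power2_norm_eq_inner inner_vec_def by (simp add: power2_eq_square)

lemma norm_matrix_squared_columns:
  fixes M :: "real^'n^'n"
  shows "(norm M)\<^sup>2 = (\<Sum>j\<in>UNIV. (norm (column j M))\<^sup>2)"
  unfolding norm_matrix_squared power2_norm_eq_inner inner_vec_def
  by (subst sum.swap) (simp add: power2_eq_square column_def)

lemma norm_transpose:
  fixes M :: "real^'n^'n"
  shows "norm (transpose M) = norm M"
proof -
  have "(norm (transpose M))\<^sup>2 = (norm M)\<^sup>2"
    unfolding norm_matrix_squared by (subst sum.swap) (simp add: transpose_def)
  then show ?thesis by simp
qed

lemma norm_matrix_mult_sq_le:
  fixes U M :: "real^'n^'n"
  assumes "\<And>x. (norm (U *v x))\<^sup>2 \<le> K * (norm x)\<^sup>2"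
  shows "(norm (U ** M))\<^sup>2 \<le> K * (norm M)\<^sup>2"
proof -
  have "column j (U ** M) = U *v column j M" for j
    by (simp add: column_def matrix_matrix_mult_def matrix_vector_mult_def vec_eq_iff)
  then show ?thesis
    unfolding norm_matrix_squared_columns sum_distrib_left
    by (simp add: assms sum_mono)
qed

text \<open>The trace is cyclic. Each \<open>d i\<close> is the form of A at a column of T, whose
  squared length is at most K. For the squares, the bound on T^T is applied twice, once on each side
  of A.\<close>

lemma simultaneous_diagonalization_bounds:
  fixes \<Sigma> A T :: "real^'n^'n"
  assumes T: "\<Sigma> = T ** transpose T" and d: "transpose T ** A ** T = diag_mat d"
    and sym: "transpose A = A"
    and K: "\<And>x. x \<bullet> (\<Sigma> *v x) \<le> K * (x \<bullet> x)"
    and b: "\<And>x. \<bar>x \<bullet> (A *v x)\<bar> \<le> b * (x \<bullet> x)"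
  shows "(\<Sum>i\<in>UNIV. d i) = trace (A ** \<Sigma>)"
    and "\<bar>d i\<bar> \<le> K * b"
    and "(\<Sum>i\<in>UNIV. (d i)\<^sup>2) \<le> K\<^sup>2 * (norm A)\<^sup>2"
proof -
  have "trace (diag_mat d) = trace ((transpose T ** A) ** T)"
    by (simp only: d)
  also have "\<dots> = trace (A ** \<Sigma>)"
    using trace_mul_sym[of "transpose T" "A ** T"] trace_mul_sym[of "A ** T" "transpose T"]
    by (simp add: T matrix_mul_assoc)
  finally show "(\<Sum>i\<in>UNIV. d i) = trace (A ** \<Sigma>)"
    by (simp add: trace_def diag_mat_def)
  have Tt: "(norm (transpose T *v x))\<^sup>2 \<le> K * (norm x)\<^sup>2" for x
  proof -
    have "(norm (transpose T *v x))\<^sup>2 = x \<bullet> (\<Sigma> *v x)"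
      by (simp add: power2_norm_eq_inner T matrix_vector_mul_assoc [symmetric] dot_lmul_matrix[symmetric])
    then show ?thesis
      using K[of x] by (simp add: power2_norm_eq_inner)
  qed
  have K0: "K \<ge> 0"
    using Tt[of "axis undefined 1"] by (simp add: norm_axis_1) (meson order_trans zero_le_power2)
  have b0: "b \<ge> 0"
    using b[of "axis undefined 1"] by (simp add: inner_axis)
  \<comment> \<open>T inherits the bound of T^T by Cauchy-Schwarz: |T e|^2 = e . T^T (T e) <= |e|
    |T^T (T e)|. After squaring, one factor |T e|^2 is cancelled, hence the case
    distinction.\<close>
  have Tn: "(norm (T *v e))\<^sup>2 \<le> K * (norm e)\<^sup>2" for e
  proof (cases "T *v e = 0")
    case True
    then show ?thesis using K0 by simp
  next
    case False
    have "(norm (T *v e))\<^sup>2 = e \<bullet> (transpose T *v (T *v e))"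
      unfolding power2_norm_eq_inner
      by (metis dot_lmul_matrix transpose_matrix_vector transpose_transpose)
    also have "\<dots> \<le> norm e * norm (transpose T *v (T *v e))"
      by (rule norm_cauchy_schwarz)
    finally have "((norm (T *v e))\<^sup>2)\<^sup>2 \<le> (norm e * norm (transpose T *v (T *v e)))\<^sup>2"
      by (rule power_mono) simp
    also have "\<dots> \<le> (norm e)\<^sup>2 * (K * (norm (T *v e))\<^sup>2)"
      unfolding power_mult_distrib using Tt[of "T *v e"] by (intro mult_left_mono) auto
    finally have "(norm (T *v e))\<^sup>2 * (norm (T *v e))\<^sup>2 \<le> (K * (norm e)\<^sup>2) * (norm (T *v e))\<^sup>2"
      by (simp add: power2_eq_square[of "(norm (T *v e))\<^sup>2"] mult_ac)
    then show ?thesis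
      using False by (metis mult_right_le_imp_le zero_less_norm_iff zero_less_power)
  qed
  have "d i = (T *v axis i 1) \<bullet> (A *v (T *v axis i 1))"
    using arg_cong[OF d, of "\<lambda>M. M $ i $ i"]
    by (simp add: matrix_conj_entry diag_mat_def matrix_vector_mult_basis)
  then have "\<bar>d i\<bar> \<le> b * (norm (T *v axis i 1))\<^sup>2"
    using b by (simp add: power2_norm_eq_inner)
  also have "\<dots> \<le> b * K"
    using Tn[of "axis i 1"] b0 by (intro mult_left_mono) (auto simp: norm_axis_1)
  finally show "\<bar>d i\<bar> \<le> K * b" by (simp add: mult.commute)
  have "(\<Sum>i\<in>UNIV. (d i)\<^sup>2) = (norm (diag_mat d))\<^sup>2"
    unfolding norm_matrix_squared
    by (simp add: diag_mat_def power2_eq_square mult_delta_left)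
  also have "\<dots> = (norm (transpose T ** (A ** T)))\<^sup>2"
    by (simp only: d[symmetric] matrix_mul_assoc)
  \<comment> \<open>After the left factor T^T is removed, transposition turns A T into T^T A, so
    that the same bound applies again.\<close>
  also have "\<dots> \<le> K * (norm (transpose (A ** T)))\<^sup>2"
    unfolding norm_transpose by (rule norm_matrix_mult_sq_le[OF Tt])
  also have "\<dots> = K * (norm (transpose T ** A))\<^sup>2"
    by (simp add: matrix_transpose_mul sym)
  also have "\<dots> \<le> K * (K * (norm A)\<^sup>2)"
    by (intro mult_left_mono norm_matrix_mult_sq_le Tt K0)
  finally show "(\<Sum>i\<in>UNIV. (d i)\<^sup>2) \<le> K\<^sup>2 * (norm A)\<^sup>2"
    by (simp add: power2_eq_square mult_ac)
qed

subsection \<open>Concentration of Gaussian quadratic forms\<close>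

lemma matrix_vector_mult_borel_measurable [measurable (raw)]:
  fixes A :: "real^'n^'m"
  assumes "f \<in> borel_measurable M"
  shows "(\<lambda>x. A *v f x) \<in> borel_measurable M"
  by (rule measurable_compose[OF assms])
    (intro borel_measurable_continuous_onI linear_continuous_on matrix_vector_mul_bounded_linear)

text \<open>It suffices to compare boxes. The preimage of a box under T is its image under the
  inverse R, which scales volume by |det R| = 1 / |det T|.\<close>

lemma lborel_eq_density_distr_matrix:
  fixes T :: "real^'n::{finite,wellorder}^'n::_"
  assumes T: "invertible T"
  shows "lborel = density (distr lborel borel ((*v) T)) (\<lambda>_. ennreal \<bar>det T\<bar>)"
proof (rule lborel_eqI)
  fix l u :: "real^'n::_"
  assume le: "\<And>b. b \<in> Basis \<Longrightarrow> l \<bullet> b \<le> u \<bullet> b"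
  obtain R where R: "T ** R = mat 1" "R ** T = mat 1"
    using T by (auto simp: invertible_def)
  have det: "\<bar>det T\<bar> * \<bar>det R\<bar> = 1"
    using R(1) by (metis abs_mult abs_one det_I det_mul)
  have vim: "(*v) T -` box l u = (*v) R ` box l u"
  proof (intro equalityI subsetI)
    fix x assume "x \<in> (*v) T -` box l u"
    moreover have "x = R *v (T *v x)"
      by (simp add: matrix_vector_mul_assoc R)
    ultimately show "x \<in> (*v) R ` box l u" by auto
  qed (auto simp: matrix_vector_mul_assoc R)
  have box: "box l u \<in> lmeasurable" by simp
  have m: "(*v) R ` box l u \<in> lmeasurable"
    "measure lebesgue ((*v) R ` box l u) = \<bar>det R\<bar> * measure lebesgue (box l u)"
    using measurable_linear_image[OF _ box, of "(*v) R"] measure_linear_image[OF _ box, of "(*v) R"]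
    by simp_all
  have b: "(*v) T -` box l u \<in> sets borel"
    using measurable_sets[of "(*v) T" borel borel "box l u"] by simp
  have "emeasure (density (distr lborel borel ((*v) T)) (\<lambda>_. ennreal \<bar>det T\<bar>)) (box l u)
      = ennreal \<bar>det T\<bar> * emeasure lborel ((*v) T -` box l u)"
    by (simp add: emeasure_density_const emeasure_distr)
  \<comment> \<open>The volume formula for linear images concerns the completed measure, which
    agrees with \<open>lborel\<close> on this Borel set.\<close>
  also have "emeasure lborel ((*v) T -` box l u) = emeasure lebesgue ((*v) R ` box l u)"
    using b by (simp add: vim)
  also have "\<dots> = ennreal (\<bar>det R\<bar> * measure lebesgue (box l u))"
    using m by (simp add: emeasure_eq_measure2)
  also have "ennreal \<bar>det T\<bar> * \<dots> = ennreal (\<bar>det T\<bar> * \<bar>det R\<bar> * measure lebesgue (box l u))"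
    by (simp add: ennreal_mult' mult.assoc)
  also have "\<dots> = ennreal (\<Prod>b\<in>Basis. (u - l) \<bullet> b)"
    using le by (simp add: det)
  finally show "emeasure (density (distr lborel borel ((*v) T)) (\<lambda>_. ennreal \<bar>det T\<bar>)) (box l u)
      = ennreal (\<Prod>b\<in>Basis. (u - l) \<bullet> b)" .
qed simp

lemma nn_integral_lborel_matrix:
  fixes T :: "real^'n::{finite,wellorder}^'n::_"
  assumes T: "invertible T" and [measurable]: "f \<in> borel_measurable borel"
  shows "(\<integral>\<^sup>+x. f x \<partial>lborel) = ennreal \<bar>det T\<bar> * (\<integral>\<^sup>+x. f (T *v x) \<partial>lborel)"
  by (subst lborel_eq_density_distr_matrix[OF T])
    (simp add: nn_integral_density nn_integral_distr nn_integral_cmult)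

lemma spd_invertible:
  fixes \<Sigma> :: "real^'n^'n"
  assumes "\<Sigma> \<in> spd_matrices"
  shows "invertible \<Sigma>"
proof -
  have "x = 0" if "\<Sigma> *v x = 0" for x
    using assms that by (force simp: spd_matrices_def)
  then have "\<exists>B. B ** \<Sigma> = mat 1"
    by (simp add: matrix_left_invertible_ker)
  then show ?thesis
    by (simp add: invertible_left_inverse)
qed

lemma nn_integral_centered_normal:
  fixes \<Sigma> T :: "real^'n::{finite,wellorder}^'n::_"
  assumes spd: "\<Sigma> \<in> spd_matrices" and T: "\<Sigma> = T ** transpose T"
    and [measurable]: "f \<in> borel_measurable borel"
  shows "(\<integral>\<^sup>+x. f x \<partial>centered_normal \<Sigma>) =
    (\<integral>\<^sup>+z. f (T *v z) * ennreal (exp (- (z \<bullet> z) / 2) / sqrt ((2 * pi) ^ CARD('n))) \<partial>lborel)"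
proof -
  have inv\<Sigma>: "invertible \<Sigma>"
    using spd by (rule spd_invertible)
  have det\<Sigma>: "det \<Sigma> = (det T)\<^sup>2"
    by (simp add: T det_mul power2_eq_square)
  then have detT: "det T \<noteq> 0"
    using inv\<Sigma> by (auto simp: invertible_det_nz)
  then have invT: "invertible T"
    by (simp add: invertible_det_nz)
  have q: "(T *v z) \<bullet> (matrix_inv \<Sigma> *v (T *v z)) = z \<bullet> z" for z
  proof -
    \<comment> \<open>From T T^T w = T z, cancelling T gives T^T w = z, so (T z) . w = z . (T^T w) =
      z . z.\<close>
    define w where "w = matrix_inv \<Sigma> *v (T *v z)"
    have "\<Sigma> ** matrix_inv \<Sigma> = mat 1"
      using someI_ex[OF inv\<Sigma>[unfolded invertible_def]] by (simp add: matrix_inv_def)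
    then have "\<Sigma> *v w = T *v z"
      by (simp add: w_def matrix_vector_mul_assoc matrix_mul_assoc)
    then have "T *v (transpose T *v w) = T *v z"
      by (simp only: T matrix_vector_mul_assoc)
    then have "transpose T *v w = z"
      using invT by (metis matrix_vector_mul_assoc matrix_vector_mul_lid invertible_def)
    then show ?thesis
      unfolding w_def[symmetric]
      by (metis dot_lmul_matrix inner_commute transpose_matrix_vector)
  qed
  have eq: "ennreal \<bar>det T\<bar> * (c * ennreal (e / sqrt ((2 * pi) ^ CARD('n) * det \<Sigma>))) =
      c * ennreal (e / sqrt ((2 * pi) ^ CARD('n)))" if "e \<ge> 0" for c e
  proof -
    have "e / sqrt ((2 * pi) ^ CARD('n)) = \<bar>det T\<bar> * (e / sqrt ((2 * pi) ^ CARD('n) * det \<Sigma>))"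
      using detT by (simp add: det\<Sigma> real_sqrt_mult)
    then have "ennreal (e / sqrt ((2 * pi) ^ CARD('n))) =
        ennreal \<bar>det T\<bar> * ennreal (e / sqrt ((2 * pi) ^ CARD('n) * det \<Sigma>))"
      using that by (simp only: ennreal_mult')
    then show ?thesis
      by (simp add: mult_ac)
  qed
  let ?h = "\<lambda>x. exp (- (x \<bullet> (matrix_inv \<Sigma> *v x)) / 2) / sqrt ((2 * pi) ^ CARD('n) * det \<Sigma>)"
  have "(\<integral>\<^sup>+x. f x \<partial>centered_normal \<Sigma>) = (\<integral>\<^sup>+x. f x * ennreal (?h x) \<partial>lborel)"
    unfolding centered_normal_def by (subst nn_integral_density) (auto simp: mult.commute)
  also have "\<dots> = ennreal \<bar>det T\<bar> * (\<integral>\<^sup>+z. f (T *v z) * ennreal (?h (T *v z)) \<partial>lborel)"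
    by (rule nn_integral_lborel_matrix[OF invT]) measurable
  also have "\<dots> = (\<integral>\<^sup>+z. ennreal \<bar>det T\<bar> * (f (T *v z) * ennreal (?h (T *v z))) \<partial>lborel)"
    by (rule nn_integral_cmult[symmetric]) measurable
  finally show ?thesis
    by (simp only: q eq exp_ge_zero)
qed

section \<open>Exponential moments of Gaussian quadratic forms\<close>

lemma nn_integral_lborel_vec_prod:
  fixes f :: "'n::finite \<Rightarrow> real \<Rightarrow> ennreal"
  assumes [measurable]: "\<And>i. f i \<in> borel_measurable borel"
  shows "(\<integral>\<^sup>+x. (\<Prod>i\<in>UNIV. f i (x $ i)) \<partial>lborel) = (\<Prod>i\<in>UNIV. \<integral>\<^sup>+t. f i t \<partial>lborel)"
proof -
  let ?a = "\<lambda>i::'n. axis i (1::real)"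
  have inj: "inj ?a"
    by (simp add: inj_on_def axis_eq_axis)
  have Basis: "Basis = range ?a"
    by (auto simp: Basis_vec_def)
  have "(\<integral>\<^sup>+x. (\<Prod>b\<in>Basis. f (inv ?a b) (x \<bullet> b)) \<partial>lborel)
      = (\<Prod>b\<in>Basis. \<integral>\<^sup>+t. f (inv ?a b) t \<partial>lborel)"
    by (rule nn_integral_lborel_prod) auto
  then show ?thesis
    unfolding Basis prod.reindex[OF inj] by (simp add: inv_f_f[OF inj] inner_axis)
qed

text \<open>The tilted density is s times the centered normal density of variance s^2 = 1 / (1 - 2
  y), which integrates to 1.\<close>

lemma nn_integral_exp_square_std_normal:
  fixes y :: real
  assumes "2 * y < 1"
  shows "(\<integral>\<^sup>+t. ennreal (exp (y * t\<^sup>2) * std_normal_density t) \<partial>lborel)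
    = ennreal (1 / sqrt (1 - 2 * y))"
proof -
  define s where "s = 1 / sqrt (1 - 2 * y)"
  have s: "s > 0" "1 / s\<^sup>2 = 1 - 2 * y"
    using assms by (auto simp: s_def power_divide)
  have "exp (y * t\<^sup>2) * std_normal_density t = s * normal_density 0 s t" for t
  proof -
    have "- t\<^sup>2 / (2 * s\<^sup>2) = - t\<^sup>2 / 2 * (1 / s\<^sup>2)" by simp
    also have "\<dots> = y * t\<^sup>2 + - t\<^sup>2 / 2"
      unfolding s(2) by (simp add: field_simps)
    finally have "exp (- t\<^sup>2 / (2 * s\<^sup>2)) = exp (y * t\<^sup>2) * exp (- t\<^sup>2 / 2)"
      by (simp only: exp_add)
    then show ?thesis
      using s(1) by (simp add: normal_density_def real_sqrt_mult)
  qed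
  then have "(\<integral>\<^sup>+t. ennreal (exp (y * t\<^sup>2) * std_normal_density t) \<partial>lborel)
      = ennreal s * (\<integral>\<^sup>+t. ennreal (normal_density 0 s t) \<partial>lborel)"
    using s(1) by (simp add: ennreal_mult nn_integral_cmult)
  also have "(\<integral>\<^sup>+t. ennreal (normal_density 0 s t) \<partial>lborel) = 1"
    using s(1) by (subst nn_integral_eq_integral) auto
  finally show ?thesis by (simp add: s_def)
qed

text \<open>In the coordinates x = T z both the quadratic form and the exponent of the density are
  sums over coordinates, so the integral factors into one-dimensional moments of squared
  normals.\<close>

lemma nn_integral_exp_quadratic_centered_normal:
  fixes \<Sigma> T A :: "real^'n::{finite,wellorder}^'n::_"
  assumes spd: "\<Sigma> \<in> spd_matrices" and T: "\<Sigma> = T ** transpose T"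
    and d: "transpose T ** A ** T = diag_mat d"
    and \<theta>: "\<And>i. 2 * \<theta> * d i < 1"
  shows "(\<integral>\<^sup>+x. ennreal (exp (\<theta> * (x \<bullet> (A *v x)))) \<partial>centered_normal \<Sigma>)
    = (\<Prod>i\<in>UNIV. ennreal (1 / sqrt (1 - 2 * (\<theta> * d i))))"
proof -
  have q: "(T *v z) \<bullet> (A *v (T *v z)) = (\<Sum>i\<in>UNIV. d i * (z $ i)\<^sup>2)" for z
  proof -
    have "(T *v z) \<bullet> (A *v (T *v z)) = z \<bullet> ((transpose T ** A ** T) *v z)"
      by (metis dot_lmul_matrix inner_commute matrix_vector_mul_assoc transpose_matrix_vector)
    also have "\<dots> = (\<Sum>i\<in>UNIV. d i * (z $ i)\<^sup>2)"
      unfolding d inner_vec_def matrix_vector_mult_def diag_mat_def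
      by (simp add: mult_delta_left) (simp add: power2_eq_square mult_ac)
    finally show ?thesis .
  qed
  have e: "ennreal (exp (\<theta> * ((T *v z) \<bullet> (A *v (T *v z))))) *
      ennreal (exp (- (z \<bullet> z) / 2) / sqrt ((2 * pi) ^ CARD('n)))
    = (\<Prod>i\<in>UNIV. ennreal (exp (\<theta> * d i * (z $ i)\<^sup>2) * std_normal_density (z $ i)))" for z :: "real^'n::_"
  proof -
    have "exp (- (z \<bullet> z) / 2) / sqrt ((2 * pi) ^ CARD('n)) = (\<Prod>i\<in>UNIV. std_normal_density (z $ i))"
    proof -
      have "- (z \<bullet> z) / 2 = (\<Sum>i\<in>UNIV. - (z $ i)\<^sup>2 / 2)"
        by (simp add: inner_vec_def power2_eq_square sum_negf sum_divide_distrib)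
      then have "exp (- (z \<bullet> z) / 2) = (\<Prod>i\<in>UNIV. exp (- (z $ i)\<^sup>2 / 2))"
        by (simp only: exp_sum[OF finite])
      then show ?thesis
        by (simp add: std_normal_density_def prod_dividef real_sqrt_power[symmetric])
    qed
    moreover have "exp (\<theta> * ((T *v z) \<bullet> (A *v (T *v z)))) = (\<Prod>i\<in>UNIV. exp (\<theta> * d i * (z $ i)\<^sup>2))"
      unfolding q by (simp add: exp_sum[symmetric] sum_distrib_left mult.assoc)
    ultimately show ?thesis
      by (simp add: prod_ennreal prod.distrib ennreal_mult'' [symmetric] prod_nonneg)
  qed
  have "(\<integral>\<^sup>+x. ennreal (exp (\<theta> * (x \<bullet> (A *v x)))) \<partial>centered_normal \<Sigma>)
      = (\<integral>\<^sup>+z. (\<Prod>i\<in>UNIV. ennreal (exp (\<theta> * d i * (z $ i)\<^sup>2) * std_normal_density (z $ i)))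
          \<partial>(lborel :: (real^'n::_) measure))"
    unfolding e[symmetric] by (rule nn_integral_centered_normal[OF spd T]) measurable
  also have "\<dots> = (\<Prod>i\<in>UNIV. \<integral>\<^sup>+t. ennreal (exp (\<theta> * d i * t\<^sup>2) * std_normal_density t) \<partial>lborel)"
    by (rule nn_integral_lborel_vec_prod) measurable
  also have "\<dots> = (\<Prod>i\<in>UNIV. ennreal (1 / sqrt (1 - 2 * (\<theta> * d i))))"
    using \<theta> by (intro prod.cong refl nn_integral_exp_square_std_normal) (simp add: mult.assoc)
  finally show ?thesis .
qed

text \<open>The total mass is the exponential moment at \<theta> = 0, where every factor is 1. The
  identity serves as the symmetric matrix to be diagonalized.\<close>

lemma prob_space_centered_normal:
  fixes \<Sigma> :: "real^'n::{finite,wellorder}^'n::_"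
  assumes spd: "\<Sigma> \<in> spd_matrices"
  shows "prob_space (centered_normal \<Sigma>)"
proof
  have "transpose (mat 1) = (mat 1 :: real^'n::_^'n::_)"
    by simp
  then obtain T :: "real^'n::_^'n::_" and d where T: "\<Sigma> = T ** transpose T"
    and d: "transpose T ** mat 1 ** T = diag_mat d"
    using simultaneous_diagonalization[OF spd] by metis
  show "emeasure (centered_normal \<Sigma>) (space (centered_normal \<Sigma>)) = 1"
    using nn_integral_exp_quadratic_centered_normal[OF spd T d, of 0] by simp
qed

section \<open>From logarithmic bounds to the Chernoff tail\<close>

lemma minus_ln_one_minus_le:
  fixes x \<beta> :: real
  assumes "\<bar>x\<bar> \<le> \<beta>" "\<beta> < 1"
  shows "- ln (1 - x) \<le> x + x\<^sup>2 / (2 * (1 - \<beta>))"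
proof -
  \<comment> \<open>The derivative of g has the sign of t for t <= \<beta>, because its other factor
    is nonnegative there. So g decreases up to 0 and increases from 0 to x, and g 0 = 0.\<close>
  define g where "g t = t + t\<^sup>2 / (2 * (1 - \<beta>)) + ln (1 - t)" for t
  have deriv: "(g has_real_derivative t * (1 / (1 - \<beta>) - 1 / (1 - t))) (at t)" if "t < 1" for t
  proof -
    have "(g has_real_derivative 1 + 2 * t / (2 * (1 - \<beta>)) - 1 / (1 - t)) (at t)"
      unfolding g_def using that assms(2) by (auto intro!: derivative_eq_intros)
    moreover have "1 + 2 * t / (2 * (1 - \<beta>)) - 1 / (1 - t) = t * (1 / (1 - \<beta>) - 1 / (1 - t))"
      using that assms(2) by (simp add: divide_simps) (simp add: algebra_simps)
    ultimately show ?thesis by simp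
  qed
  have sgn: "0 \<le> 1 / (1 - \<beta>) - 1 / (1 - t)" if "t \<le> \<beta>" for t
    using that assms(2) by (simp add: frac_le)
  have "g 0 \<le> g x"
  proof (cases "0 \<le> x")
    case True
    show ?thesis
    proof (rule DERIV_nonneg_imp_nondecreasing[OF True])
      fix t assume "0 \<le> t" "t \<le> x"
      then show "\<exists>y. (g has_real_derivative y) (at t) \<and> 0 \<le> y"
        using deriv[of t] sgn[of t] assms by (intro exI[of _ "t * (1 / (1 - \<beta>) - 1 / (1 - t))"]) auto
    qed
  next
    case False
    show ?thesis
    proof (rule DERIV_nonpos_imp_nonincreasing[of x 0 g])
      fix t assume "x \<le> t" "t \<le> 0"
      then show "\<exists>y. (g has_real_derivative y) (at t) \<and> y \<le> 0"
        using deriv[of t] sgn[of t] assms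
        by (intro exI[of _ "t * (1 / (1 - \<beta>) - 1 / (1 - t))"]) (auto simp: mult_le_0_iff)
    qed (use False in simp)
  qed
  then show ?thesis by (simp add: g_def)
qed

lemma inverse_sqrt_le_exp:
  fixes y \<beta> :: real
  assumes "2 * \<bar>y\<bar> \<le> \<beta>" "\<beta> < 1"
  shows "1 / sqrt (1 - 2 * y) \<le> exp (y + y\<^sup>2 / (1 - \<beta>))"
proof -
  have pos: "1 - 2 * y > 0" using assms by linarith
  have sqrt: "1 / sqrt (1 - 2 * y) = exp (- ln (1 - 2 * y) / 2)"
    using pos by (simp add: exp_minus ln_sqrt[symmetric] inverse_eq_divide)
  have "- ln (1 - 2 * y) / 2 \<le> (2 * y + (2 * y)\<^sup>2 / (2 * (1 - \<beta>))) / 2"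
    using minus_ln_one_minus_le[of "2 * y" \<beta>] assms by (intro divide_right_mono) auto
  also have "\<dots> = y + y\<^sup>2 / (1 - \<beta>)"
    using assms by (simp add: field_simps)
  finally show ?thesis
    unfolding sqrt by simp
qed

lemma sets_centered_normal [measurable_cong]: "sets (centered_normal \<Sigma>) = sets borel"
  by (simp add: centered_normal_def)

text \<open>\<open>inverse_sqrt_le_exp\<close> is applied to every factor with the common \<beta> =
  2 \<theta> K a. All exponents then share one denominator, and only the sums of \<open>d i\<close>
  and of their squares remain.\<close>

lemma mgf_quadratic_le:
  fixes \<Sigma> A :: "real^'n::{finite,wellorder}^'n::_"
  assumes spd: "\<Sigma> \<in> spd_matrices" and sym: "transpose A = A"
    and K: "\<And>x. x \<bullet> (\<Sigma> *v x) \<le> K * (x \<bullet> x)"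
    and a: "\<And>x. \<bar>x \<bullet> (A *v x)\<bar> \<le> a * (x \<bullet> x)"
    and V: "(norm A)\<^sup>2 \<le> V"
    and \<theta>: "0 \<le> \<theta>" "2 * \<theta> * (K * a) < 1"
  shows "(\<integral>\<^sup>+x. ennreal (exp (\<theta> * (x \<bullet> (A *v x)))) \<partial>centered_normal \<Sigma>)
    \<le> ennreal (exp (\<theta> * trace (A ** \<Sigma>) + \<theta>\<^sup>2 * (K\<^sup>2 * V) / (1 - 2 * \<theta> * (K * a))))"
proof -
  obtain T :: "real^'n::_^'n::_" and d where T: "\<Sigma> = T ** transpose T"
    and d: "transpose T ** A ** T = diag_mat d"
    using simultaneous_diagonalization[OF spd sym] by metis
  note bounds = simultaneous_diagonalization_bounds[OF T d sym K a]
  have \<theta>d: "2 * \<bar>\<theta> * d i\<bar> \<le> 2 * \<theta> * (K * a)" for i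
    using bounds(2)[of i] \<theta>(1) by (simp add: abs_mult mult_left_mono)
  have \<theta>d1: "2 * \<theta> * d i < 1" for i
  proof -
    have "2 * \<theta> * d i \<le> 2 * \<bar>\<theta> * d i\<bar>" for i by simp
    then show ?thesis using \<theta>(2) \<theta>d[of i] by (meson le_less_trans)
  qed
  have "(\<integral>\<^sup>+x. ennreal (exp (\<theta> * (x \<bullet> (A *v x)))) \<partial>centered_normal \<Sigma>)
      = (\<Prod>i\<in>UNIV. ennreal (1 / sqrt (1 - 2 * (\<theta> * d i))))"
    by (rule nn_integral_exp_quadratic_centered_normal[OF spd T d \<theta>d1])
  also have "\<dots> = ennreal (\<Prod>i\<in>UNIV. 1 / sqrt (1 - 2 * (\<theta> * d i)))"
    using \<theta>d1 by (intro prod_ennreal) (simp add: mult.assoc less_imp_le)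
  also have "\<dots> \<le> ennreal (\<Prod>i\<in>UNIV. exp (\<theta> * d i + (\<theta> * d i)\<^sup>2 / (1 - 2 * \<theta> * (K * a))))"
    using \<theta>d1
    by (intro ennreal_leI prod_mono conjI inverse_sqrt_le_exp \<theta>d \<theta>) (simp add: mult.assoc less_imp_le)
  also have "(\<Prod>i\<in>UNIV. exp (\<theta> * d i + (\<theta> * d i)\<^sup>2 / (1 - 2 * \<theta> * (K * a))))
      = exp (\<theta> * (\<Sum>i\<in>UNIV. d i) + \<theta>\<^sup>2 * (\<Sum>i\<in>UNIV. (d i)\<^sup>2) / (1 - 2 * \<theta> * (K * a)))"
    by (simp add: exp_sum[symmetric] sum.distrib sum_distrib_left sum_divide_distrib power_mult_distrib)
  also have "ennreal \<dots> \<le> ennreal (exp (\<theta> * trace (A ** \<Sigma>) + \<theta>\<^sup>2 * (K\<^sup>2 * V) / (1 - 2 * \<theta> * (K * a))))"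
  proof -
    have "(\<Sum>i\<in>UNIV. (d i)\<^sup>2) \<le> K\<^sup>2 * V"
      using bounds(3) V by (meson order_trans mult_left_mono zero_le_power2)
    then show ?thesis
      using \<theta> unfolding bounds(1)
      by (intro ennreal_leI) (auto intro!: divide_right_mono mult_left_mono)
  qed
  finally show ?thesis .
qed

text \<open>Markov's inequality for the exponential of \<theta> times the sum, with independence
  making its expectation a product of n equal factors. The set E enters through inclusion in a level
  set, so measurability is checked for that level set alone.\<close>

lemma quadratic_form_tail:
  fixes \<Sigma> A :: "real^'n::{finite,wellorder}^'n::_"
  assumes spd: "\<Sigma> \<in> spd_matrices" and sym: "transpose A = A"
    and K: "\<And>x. x \<bullet> (\<Sigma> *v x) \<le> K * (x \<bullet> x)"
    and a: "\<And>x. \<bar>x \<bullet> (A *v x)\<bar> \<le> a * (x \<bullet> x)"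
    and V: "(norm A)\<^sup>2 \<le> V"
    and pos: "0 < K" "0 < a" "0 < V" "0 < y"
    and E: "E \<subseteq> space (sample_law n \<Sigma>)"
      "\<And>X. X \<in> E \<Longrightarrow> real n * (trace (A ** \<Sigma>) + K * (2 * sqrt (V * y) + 2 * a * y))
        \<le> (\<Sum>k = 1..n. X k \<bullet> (A *v X k))"
  shows "measure (sample_law n \<Sigma>) E \<le> exp (- (real n * y))"
proof -
  define D where "D = sqrt V + 2 * a * sqrt y"
  define \<theta> where "\<theta> = sqrt y / (K * D)"
    \<comment> \<open>with this parameter the Chernoff exponent is exactly \<open>- n y\<close>\<close>
  define \<tau> where "\<tau> = trace (A ** \<Sigma>)"
  define \<psi> where "\<psi> = \<theta> * \<tau> + \<theta>\<^sup>2 * (K\<^sup>2 * V) / (1 - 2 * \<theta> * (K * a))"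
  define \<delta> where "\<delta> = \<tau> + K * (2 * sqrt (V * y) + 2 * a * y)"
  have D: "D > 0" unfolding D_def using pos by (simp add: add_pos_pos)
  have \<theta>: "\<theta> > 0" unfolding \<theta>_def using pos D by simp
  \<comment> \<open>D exceeds sqrt V by 2 a sqrt y, and 2 \<theta> K a is this excess divided by D.
    Positivity of the quotient makes \<theta> admissible in \<open>mgf_quadratic_le\<close>.\<close>
  have one: "1 - 2 * \<theta> * (K * a) = sqrt V / D"
    using pos D by (simp add: \<theta>_def field_simps) (simp add: D_def)
  then have \<theta>1: "2 * \<theta> * (K * a) < 1"
    using pos D by (smt (verit) divide_pos_pos real_sqrt_gt_zero)
  \<comment> \<open>The variance term equals y sqrt V / D. The deviation in \<delta>, multiplied by
    \<theta>, gives the same amount plus y, so the difference per observation is - y.\<close>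
  have key: "\<psi> = \<theta> * \<delta> - y"
  proof -
    have 1: "\<theta>\<^sup>2 * (K\<^sup>2 * V) / (sqrt V / D) = y * sqrt V / D"
    proof -
      have "\<theta>\<^sup>2 * (K\<^sup>2 * V) = y * V / D\<^sup>2"
        using pos D by (simp add: \<theta>_def power_divide power_mult_distrib)
      also have "\<dots> / (sqrt V / D) = y * (V / sqrt V) / D"
        using D by (simp add: power2_eq_square)
      finally show ?thesis
        using pos by (simp add: real_div_sqrt)
    qed
    have "\<theta> * (K * (2 * sqrt (V * y) + 2 * a * y)) = sqrt y / D * (2 * sqrt (V * y) + 2 * a * y)"
      using pos by (simp add: \<theta>_def)
    also have "\<dots> = (2 * (sqrt y * sqrt y) * sqrt V + 2 * a * y * sqrt y) / D"
      by (simp add: real_sqrt_mult ring_distribs mult_ac add_divide_distrib del: real_sqrt_mult_self)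
    also have "\<dots> = y * sqrt V / D + y * D / D"
      using pos by (simp add: D_def add_divide_distrib[symmetric] algebra_simps del: add_divide_distrib)
    finally have 2: "\<theta> * (K * (2 * sqrt (V * y) + 2 * a * y)) = y * sqrt V / D + y"
      using D by simp
    show ?thesis
      unfolding \<psi>_def one 1 \<delta>_def using 2 by (simp add: algebra_simps)
  qed
  interpret prob_space "centered_normal \<Sigma>"
    by (rule prob_space_centered_normal[OF spd])
  interpret product_sigma_finite "\<lambda>k::nat. centered_normal \<Sigma>"
    by standard
  let ?N = "sample_law n \<Sigma>"
  let ?q = "\<lambda>X. \<Sum>k = 1..n. X k \<bullet> (A *v X k)"
  have [measurable]: "(\<lambda>x. x \<bullet> (A *v x)) \<in> borel_measurable (centered_normal \<Sigma>)"
    by measurable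
  have [measurable]: "?q \<in> borel_measurable ?N"
    unfolding sample_law_def
    by (intro borel_measurable_sum measurable_compose[OF measurable_component_singleton]) auto
  have "emeasure ?N E
      \<le> emeasure ?N {X \<in> space ?N. 1 \<le> ennreal (exp (- (real n * (\<theta> * \<delta>)))) * ennreal (exp (\<theta> * ?q X))}"
  proof (intro emeasure_mono subsetI)
    fix X assume "X \<in> E"
    then have X: "X \<in> space ?N" "real n * \<delta> \<le> ?q X"
      using E by (auto simp: \<delta>_def \<tau>_def)
    then have "\<theta> * (real n * \<delta>) \<le> \<theta> * ?q X"
      using \<theta> by (intro mult_left_mono) auto
    then have "1 \<le> exp (- (real n * (\<theta> * \<delta>))) * exp (\<theta> * ?q X)"
      by (simp add: exp_add[symmetric] mult_ac)
    then show "X \<in> {X \<in> space ?N. 1 \<le> ennreal (exp (- (real n * (\<theta> * \<delta>)))) * ennreal (exp (\<theta> * ?q X))}"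
      using X by (simp add: ennreal_mult[symmetric])
  qed measurable
  also have "\<dots> \<le> ennreal (exp (- (real n * (\<theta> * \<delta>)))) *
      (\<integral>\<^sup>+X. ennreal (exp (\<theta> * ?q X)) * indicator (space ?N) X \<partial>?N)"
    by (rule nn_integral_Markov_inequality) measurable
  also have "(\<integral>\<^sup>+X. ennreal (exp (\<theta> * ?q X)) * indicator (space ?N) X \<partial>?N)
      = (\<integral>\<^sup>+X. (\<Prod>k\<in>{1..n}. ennreal (exp (\<theta> * (X k \<bullet> (A *v X k))))) \<partial>?N)"
    by (intro nn_integral_cong) (simp add: sum_distrib_left exp_sum prod_ennreal)
  also have "\<dots> = (\<Prod>k\<in>{1..n}. \<integral>\<^sup>+x. ennreal (exp (\<theta> * (x \<bullet> (A *v x)))) \<partial>centered_normal \<Sigma>)"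
    unfolding sample_law_def by (rule product_nn_integral_prod) auto
  also have "\<dots> \<le> (\<Prod>k\<in>{1..n}. ennreal (exp \<psi>))"
    unfolding \<psi>_def \<tau>_def
    using mgf_quadratic_le[OF spd sym K a V less_imp_le[OF \<theta>] \<theta>1]
    by (simp add: power_mono_ennreal)
  also have "(\<Prod>k\<in>{1..n}. ennreal (exp \<psi>)) = ennreal (exp (real n * \<psi>))"
    by (simp add: ennreal_power exp_of_nat_mult)
  also have "ennreal (exp (- (real n * (\<theta> * \<delta>)))) * \<dots> = ennreal (exp (- (real n * y)))"
    unfolding key by (simp add: ennreal_mult[symmetric] exp_add[symmetric] algebra_simps)
  finally have "emeasure ?N E \<le> ennreal (exp (- (real n * y)))"
    by (simp add: mult_left_mono)
  then show ?thesis
    unfolding measure_def by (intro enn2real_leI) auto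
qed

subsection \<open>Sums over lags\<close>

lemma idx_strict_mono: "i < j \<Longrightarrow> idx i < idx (j :: 'p::{finite,wellorder})"
  unfolding idx_def by (rule psubset_card_mono) (auto simp: psubset_eq intro: order.strict_trans)

lemma bij_betw_idx: "bij_betw (idx :: 'p::{finite,wellorder} \<Rightarrow> nat) UNIV {..<CARD('p)}"
proof -
  have inj: "inj (idx :: 'p \<Rightarrow> nat)"
    by (rule injI) (metis idx_strict_mono less_irrefl neq_iff)
  have "range (idx :: 'p \<Rightarrow> nat) \<subseteq> {..<CARD('p)}"
    unfolding idx_def by (auto intro!: psubset_card_mono)
  then have "range (idx :: 'p \<Rightarrow> nat) = {..<CARD('p)}"
    using inj by (intro card_subset_eq) (auto simp: card_image)
  with inj show ?thesis
    by (simp add: bij_betw_def)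
qed

lemma lag_commute: "lag i j = lag j i"
  by (simp add: lag_def abs_minus_commute)

text \<open>Moves sums from the abstract index type to the numbers below p, where they can be split
  and reindexed.\<close>

lemma sum_lag_idx:
  "(\<Sum>l\<in>UNIV. f (lag k (l :: 'p::{finite,wellorder}))) =
    (\<Sum>v<CARD('p). f (nat \<bar>int (idx k) - int v\<bar>))"
  using sum.reindex_bij_betw[OF bij_betw_idx, of "\<lambda>v. f (nat \<bar>int (idx k) - int v\<bar>)"]
  by (simp add: lag_def)

lemma sum_lag_row:
  fixes f :: "nat \<Rightarrow> real"
  assumes "u < p"
  shows "(\<Sum>v<p. f (nat \<bar>int u - int v\<bar>)) = f 0 + (\<Sum>j = 1..u. f j) + (\<Sum>j = 1..p - 1 - u. f j)"
proof -
  have split: "{..<p} = {..<u} \<union> {u} \<union> {u<..<p}"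
    using assms by auto
  have "(\<Sum>v<p. f (nat \<bar>int u - int v\<bar>)) = (\<Sum>v<u. f (nat \<bar>int u - int v\<bar>)) + f 0
      + (\<Sum>v\<in>{u<..<p}. f (nat \<bar>int u - int v\<bar>))"
    unfolding split by (subst sum.union_disjoint, auto)+
  also have "(\<Sum>v<u. f (nat \<bar>int u - int v\<bar>)) = (\<Sum>j = 1..u. f j)"
    by (rule sum.reindex_bij_witness[of _ "\<lambda>j. u - j" "\<lambda>v. u - v"])
      (auto simp: of_nat_diff nat_diff_distrib)
  also have "(\<Sum>v\<in>{u<..<p}. f (nat \<bar>int u - int v\<bar>)) = (\<Sum>j = 1..p - 1 - u. f j)"
    by (rule sum.reindex_bij_witness[of _ "\<lambda>j. u + j" "\<lambda>v. v - u"])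
      (auto simp: nat_diff_distrib abs_if)
  finally show ?thesis by simp
qed

text \<open>A row meets each positive lag at most once on either side of the diagonal, hence the
  factor 2.\<close>

lemma sum_lag_le:
  fixes f :: "nat \<Rightarrow> real" and k :: "'p::{finite,wellorder}"
  assumes "\<And>j. 0 \<le> f j"
  shows "(\<Sum>l\<in>UNIV. f (lag k l)) \<le> f 0 + 2 * (\<Sum>j = 1..CARD('p) - 1. f j)"
proof -
  have u: "idx k < CARD('p)"
    using bij_betw_idx by (auto simp: bij_betw_def)
  have "(\<Sum>j = 1..idx k. f j) \<le> (\<Sum>j = 1..CARD('p) - 1. f j)"
    "(\<Sum>j = 1..CARD('p) - 1 - idx k. f j) \<le> (\<Sum>j = 1..CARD('p) - 1. f j)"
    using u assms by (auto intro!: sum_mono2)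
  then show ?thesis
    by (simp add: sum_lag_idx sum_lag_row[OF u])
qed

text \<open>The term f j occurs for u = j, ..., p - 1, that is, p - j times.\<close>

lemma sum_sum_initial:
  fixes f :: "nat \<Rightarrow> real"
  shows "(\<Sum>u<p. \<Sum>j = 1..u. f j) = (\<Sum>j = 1..p - 1. (real p - real j) * f j)"
proof (induction p)
  case (Suc p)
  have "(\<Sum>u<Suc p. \<Sum>j = 1..u. f j) = (\<Sum>j = 1..p - 1. (real p - real j) * f j) + (\<Sum>j = 1..p. f j)"
    unfolding sum.lessThan_Suc Suc ..
  \<comment> \<open>The added summand j = p has weight 0.\<close>
  also have "(\<Sum>j = 1..p - 1. (real p - real j) * f j) = (\<Sum>j = 1..p. (real p - real j) * f j)"
    by (cases p) auto
  also have "\<dots> + (\<Sum>j = 1..p. f j) = (\<Sum>j = 1..p. (real p - real j) * f j + f j)"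
    by (simp add: sum.distrib)
  finally show ?case
    by (simp add: algebra_simps)
qed simp

text \<open>Lag 0 fills the diagonal, and every lag j > 0 fills two parallels of it with p - j
  entries each. The normalization of \<open>A_mat\<close> is the reciprocal of this count.\<close>

lemma sum_sum_lag:
  fixes f :: "nat \<Rightarrow> real"
  shows "(\<Sum>k\<in>UNIV. \<Sum>l\<in>UNIV. f (lag (k :: 'p::{finite,wellorder}) l))
    = real CARD('p) * f 0 + (\<Sum>j = 1..CARD('p) - 1. 2 * (real CARD('p) - real j) * f j)"
proof -
  let ?p = "CARD('p)"
  have "(\<Sum>k\<in>UNIV. \<Sum>l\<in>UNIV. f (lag (k :: 'p) l)) = (\<Sum>u<?p. \<Sum>v<?p. f (nat \<bar>int u - int v\<bar>))"
    unfolding sum_lag_idx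
    using sum.reindex_bij_betw[OF bij_betw_idx, of "\<lambda>u. \<Sum>v<?p. f (nat \<bar>int u - int v\<bar>)"] by simp
  also have "\<dots> = (\<Sum>u<?p. f 0 + (\<Sum>j = 1..u. f j) + (\<Sum>j = 1..?p - 1 - u. f j))"
    by (intro sum.cong refl sum_lag_row) simp
  also have "\<dots> = real ?p * f 0 + (\<Sum>u<?p. \<Sum>j = 1..u. f j) + (\<Sum>u<?p. \<Sum>j = 1..?p - 1 - u. f j)"
    by (simp add: sum.distrib)
  \<comment> \<open>Reversing the order of the rows exchanges the two triangles.\<close>
  also have "(\<Sum>u<?p. \<Sum>j = 1..?p - 1 - u. f j) = (\<Sum>u<?p. \<Sum>j = 1..u. f j)"
    using sum.nat_diff_reindex[of "\<lambda>u. \<Sum>j = 1..u. f j" ?p] by simp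
  finally show ?thesis
    unfolding sum_sum_initial by (simp add: sum_distrib_left algebra_simps)
qed

section \<open>Row sum bounds and the norms and traces of A_{1:S}\<close>

lemma symmetric_quadratic_form_le_row_sum:
  fixes B :: "real^'n^'n"
  assumes sym: "transpose B = B" and r: "\<And>i. (\<Sum>j\<in>UNIV. \<bar>B $ i $ j\<bar>) \<le> r"
  shows "\<bar>x \<bullet> (B *v x)\<bar> \<le> r * (x \<bullet> x)"
proof -
  have B: "B $ i $ j = B $ j $ i" for i j
    using arg_cong[OF sym, of "\<lambda>M. M $ j $ i"] by (simp add: transpose_def)
  have "x \<bullet> (B *v x) = (\<Sum>i\<in>UNIV. \<Sum>j\<in>UNIV. x $ i * B $ i $ j * x $ j)"
    by (simp add: inner_vec_def matrix_vector_mult_def sum_distrib_left mult.assoc)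
  also have "\<bar>\<dots>\<bar> \<le> (\<Sum>i\<in>UNIV. \<Sum>j\<in>UNIV. \<bar>x $ i * B $ i $ j * x $ j\<bar>)"
    by (intro order_trans[OF sum_abs] sum_mono sum_abs)
  \<comment> \<open>By |x_i x_j| <= (x_i^2 + x_j^2) / 2 the form splits into a row part and a column
    part, which symmetry makes equal.\<close>
  also have "\<dots> \<le> (\<Sum>i\<in>UNIV. \<Sum>j\<in>UNIV. \<bar>B $ i $ j\<bar> * (x $ i)\<^sup>2 / 2 + \<bar>B $ i $ j\<bar> * (x $ j)\<^sup>2 / 2)"
  proof (intro sum_mono)
    fix i j
    have "0 \<le> (\<bar>x $ i\<bar> - \<bar>x $ j\<bar>)\<^sup>2" by simp
    then have "\<bar>x $ i\<bar> * \<bar>x $ j\<bar> \<le> ((x $ i)\<^sup>2 + (x $ j)\<^sup>2) / 2"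
      by (simp add: power2_eq_square algebra_simps)
    from mult_left_mono[OF this, of "\<bar>B $ i $ j\<bar>"]
    show "\<bar>x $ i * B $ i $ j * x $ j\<bar> \<le> \<bar>B $ i $ j\<bar> * (x $ i)\<^sup>2 / 2 + \<bar>B $ i $ j\<bar> * (x $ j)\<^sup>2 / 2"
      by (simp add: abs_mult mult_ac ring_distribs add_divide_distrib)
  qed
  also have "\<dots> = (\<Sum>i\<in>UNIV. \<Sum>j\<in>UNIV. \<bar>B $ i $ j\<bar> * (x $ i)\<^sup>2 / 2)
      + (\<Sum>i\<in>UNIV. \<Sum>j\<in>UNIV. \<bar>B $ i $ j\<bar> * (x $ j)\<^sup>2 / 2)"
    by (simp add: sum.distrib)
  also have "(\<Sum>i\<in>UNIV. \<Sum>j\<in>UNIV. \<bar>B $ i $ j\<bar> * (x $ j)\<^sup>2 / 2)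
      = (\<Sum>i\<in>UNIV. \<Sum>j\<in>UNIV. \<bar>B $ i $ j\<bar> * (x $ i)\<^sup>2 / 2)"
    by (subst sum.swap) (simp add: B)
  also have "(\<Sum>i\<in>UNIV. \<Sum>j\<in>UNIV. \<bar>B $ i $ j\<bar> * (x $ i)\<^sup>2 / 2)
      + (\<Sum>i\<in>UNIV. \<Sum>j\<in>UNIV. \<bar>B $ i $ j\<bar> * (x $ i)\<^sup>2 / 2)
      = (\<Sum>i\<in>UNIV. (\<Sum>j\<in>UNIV. \<bar>B $ i $ j\<bar>) * (x $ i)\<^sup>2)"
    by (simp add: sum_distrib_right sum.distrib[symmetric])
  also have "\<dots> \<le> (\<Sum>i\<in>UNIV. r * (x $ i)\<^sup>2)"
    by (intro sum_mono mult_right_mono r) simp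
  also have "\<dots> = r * (x \<bullet> x)"
    by (simp add: inner_vec_def sum_distrib_left power2_eq_square)
  finally show ?thesis .
qed

text \<open>Exhibits the entries of A_{1:S} as a function of the lag, to which the lag sums apply.
  The value 0 at lag 0 is its zero diagonal.\<close>

definition lag_weight :: "nat \<Rightarrow> nat \<Rightarrow> nat \<Rightarrow> real" where
  "lag_weight p S j = (if j \<in> {1..S} then 1 / (2 * (real p - real j)) else 0)"

lemma A_upto_nth:
  "(A_upto S :: real^'p::{finite,wellorder}^'p::_) $ k $ l = lag_weight CARD('p) S (lag k l)"
proof -
  have "(A_upto S :: real^'p::_^'p::_) $ k $ l =
      (\<Sum>j = 1..S. if lag k l = j then 1 / (2 * (real CARD('p) - real j)) else 0)"
    by (simp add: A_upto_def A_mat_def sum_component)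
  then show ?thesis
    by (simp add: lag_weight_def)
qed

lemma transpose_A_upto [simp]:
  "transpose (A_upto S :: real^'p::{finite,wellorder}^'p::_) = A_upto S"
  by (simp add: transpose_def vec_eq_iff A_upto_nth lag_commute)

lemma sum_lag_weight:
  assumes "S < p"
  shows "(\<Sum>j = 1..p - 1. f j * lag_weight p S j) = (\<Sum>j = 1..S. f j / (2 * (real p - real j)))"
proof -
  have "(\<Sum>j = 1..p - 1. f j * lag_weight p S j) = (\<Sum>j = 1..S. f j * lag_weight p S j)"
    using assms by (intro sum.mono_neutral_right) (auto simp: lag_weight_def)
  then show ?thesis
    by (simp add: lag_weight_def)
qed

text \<open>Two entries 1 / (2 (p - j)) at most per row and lag give row sums of at most the sum of
  1 / (p - j) over j <= S, and each term is at most 1 / (p - S).\<close>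

lemma A_upto_quadratic_form_le:
  fixes x :: "real^'p::{finite,wellorder}"
  assumes "S < CARD('p)"
  shows "\<bar>x \<bullet> ((A_upto S :: real^'p::_^'p::_) *v x)\<bar> \<le> real S / (real CARD('p) - real S) * (x \<bullet> x)"
proof (rule symmetric_quadratic_form_le_row_sum)
  fix k :: 'p
  have nonneg: "0 \<le> lag_weight CARD('p) S j" for j
    using assms by (auto simp: lag_weight_def)
  have "(\<Sum>l\<in>UNIV. \<bar>(A_upto S :: real^'p::_^'p::_) $ k $ l\<bar>) = (\<Sum>l\<in>UNIV. lag_weight CARD('p) S (lag k l))"
    by (simp add: A_upto_nth nonneg)
  also have "\<dots> \<le> 2 * (\<Sum>j = 1..CARD('p) - 1. lag_weight CARD('p) S j)"
    using sum_lag_le[of "lag_weight CARD('p) S" k] nonneg by (simp add: lag_weight_def[of _ _ 0])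
  also have "\<dots> = (\<Sum>j = 1..S. 1 / (real CARD('p) - real j))"
  proof -
    have "2 / (2 * x) = 1 / x" for x :: real by simp
    then show ?thesis
      using sum_lag_weight[OF assms, of "\<lambda>_. 2"] by (simp only: sum_distrib_left)
  qed
  also have "\<dots> \<le> (\<Sum>j = 1..S. 1 / (real CARD('p) - real S))"
    using assms by (intro sum_mono frac_le) auto
  finally show "(\<Sum>l\<in>UNIV. \<bar>(A_upto S :: real^'p::_^'p::_) $ k $ l\<bar>) \<le> real S / (real CARD('p) - real S)"
    by simp
qed simp

text \<open>The 2 (p - j) entries at lag j have squares adding up to 1 / (2 (p - j)).\<close>

lemma norm_A_upto_le:
  assumes "S < CARD('p::{finite,wellorder})"
  shows "(norm (A_upto S :: real^'p::_^'p::_))\<^sup>2 \<le> real S / (2 * (real CARD('p) - real S))"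
proof -
  let ?w = "lag_weight CARD('p) S"
  have "(norm (A_upto S :: real^'p::_^'p::_))\<^sup>2 = (\<Sum>k\<in>UNIV. \<Sum>l\<in>UNIV. (?w (lag (k :: 'p) l))\<^sup>2)"
    by (simp add: norm_matrix_squared A_upto_nth)
  also have "\<dots> = (\<Sum>j = 1..CARD('p) - 1. 2 * (real CARD('p) - real j) * ?w j * ?w j)"
    by (subst sum_sum_lag) (simp add: lag_weight_def[of _ _ 0] power2_eq_square mult.assoc)
  also have "\<dots> = (\<Sum>j = 1..S. ?w j)"
    unfolding sum_lag_weight[OF assms] using assms by (intro sum.cong) auto
  also have "\<dots> \<le> (\<Sum>j = 1..S. 1 / (2 * (real CARD('p) - real S)))"
    using assms by (intro sum_mono) (auto simp: lag_weight_def intro!: frac_le)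
  finally show ?thesis by simp
qed

text \<open>The weight at lag j cancels the number of entries at that lag, so each correlation up to
  lag S is counted exactly once.\<close>

lemma trace_A_upto_mult:
  fixes \<Sigma> :: "real^'p::{finite,wellorder}^'p::_"
  assumes "S < CARD('p)" and c: "\<And>i j. \<Sigma> $ i $ j = c (lag i j)"
  shows "trace (A_upto S ** \<Sigma>) = (\<Sum>j = 1..S. c j)"
proof -
  let ?w = "lag_weight CARD('p) S"
  have "trace (A_upto S ** \<Sigma>) = (\<Sum>k\<in>UNIV. \<Sum>l\<in>UNIV. ?w (lag (k :: 'p) l) * c (lag k l))"
    by (simp add: trace_def matrix_matrix_mult_def A_upto_nth c lag_commute)
  also have "\<dots> = (\<Sum>j = 1..CARD('p) - 1. 2 * (real CARD('p) - real j) * c j * ?w j)"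
    by (subst sum_sum_lag[of "\<lambda>j. ?w j * c j"]) (simp add: lag_weight_def[of _ _ 0] mult_ac)
  also have "\<dots> = (\<Sum>j = 1..S. c j)"
    unfolding sum_lag_weight[OF assms(1)] using assms(1) by (intro sum.cong) auto
  finally show ?thesis .
qed

text \<open>For two indices at distance j, the difference of their unit vectors has quadratic form 2
  (c 0 - c j), which must be positive.\<close>

lemma spd_toeplitz_offdiag_less_1:
  fixes \<Sigma> :: "real^'p::{finite,wellorder}^'p::_"
  assumes spd: "\<Sigma> \<in> spd_matrices" and c: "\<And>i j. \<Sigma> $ i $ j = c (lag i j)"
    and j: "j \<in> {1..CARD('p) - 1}"
  shows "c j < c 0"
proof -
  have surj: "idx ` (UNIV :: 'p set) = {..<CARD('p)}"
    using bij_betw_idx by (auto simp: bij_betw_def)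
  have "0 \<in> idx ` (UNIV :: 'p set)" "j \<in> idx ` (UNIV :: 'p set)"
    unfolding surj using j by auto
  then obtain k l :: 'p where kl: "idx k = 0" "idx l = j"
    by force
  have lag: "lag k l = j" "lag l k = j" "lag k k = 0" "lag l l = 0"
    using kl by (auto simp: lag_def)
  have "k \<noteq> l" using kl j by auto
  define x :: "real^'p::_" where "x = axis k 1 - axis l 1"
  have "x \<noteq> 0"
    using \<open>k \<noteq> l\<close> by (simp add: x_def axis_eq_axis)
  then have "0 < x \<bullet> (\<Sigma> *v x)"
    using spd by (auto simp: spd_matrices_def)
  also have "x \<bullet> (\<Sigma> *v x) = 2 * (c 0 - c j)"
    by (simp add: x_def matrix_vector_mult_diff_distrib inner_diff_left inner_diff_right
        matrix_vector_mult_basis inner_axis' column_def c lag)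
  finally show ?thesis by simp
qed

text \<open>The zero diagonal makes the identity contribute nothing. The rest is linearity of the
  trace in the sample covariance.\<close>

lemma phi_sample_cov:
  fixes A :: "real^'p^'p"
  assumes diag: "\<And>i. A $ i $ i = 0"
  shows "phi A (sample_cov n X - mat 1) = (\<Sum>k = 1..n. X k \<bullet> (A *v X k)) / real n"
proof -
  have "trace (A ** (mat 1 :: real^'p^'p)) = 0"
    by (simp add: trace_def diag)
  then have "phi A (sample_cov n X - mat 1) = trace (A ** sample_cov n X)"
    by (simp add: phi_def trace_def matrix_matrix_mult_def right_diff_distrib sum_subtractf)
  also have "\<dots> = (\<Sum>i\<in>UNIV. \<Sum>j\<in>UNIV. \<Sum>k = 1..n. A $ i $ j * (X k $ j * X k $ i) / real n)"
    by (simp add: trace_def matrix_matrix_mult_def sample_cov_def sum_component sum_distrib_left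
        sum_divide_distrib)
  also have "\<dots> = (\<Sum>k = 1..n. \<Sum>i\<in>UNIV. \<Sum>j\<in>UNIV. A $ i $ j * (X k $ j * X k $ i) / real n)"
    by (subst sum.swap[of _ "{1..n}"]) (subst sum.swap[of _ "{1..n}"], rule refl)
  also have "\<dots> = (\<Sum>k = 1..n. X k \<bullet> (A *v X k)) / real n"
    by (simp add: inner_vec_def matrix_vector_mult_def sum_distrib_left sum_divide_distrib mult_ac)
  finally show ?thesis .
qed

lemma mat_1_spd: "mat 1 \<in> spd_matrices"
  by (simp add: spd_matrices_def)

subsection \<open>Risk of the test\<close>

lemma deviation_le_MS_threshold:
  assumes "1 \<le> n" "S < p" "0 < u"
  shows "2 * sqrt (real S / (2 * (real p - real S)) * (u / (4 * real n)))
      + 2 * (real S / (real p - real S)) * (u / (4 * real n)) \<le> MS_threshold n p S u"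
proof -
  define w where "w = u * real S / (real n * (real p - real S))"
  have w: "0 \<le> w" using assms by (simp add: w_def)
  have "sqrt (real S / (2 * (real p - real S)) * (u / (4 * real n))) = sqrt (w / 8)"
    using assms by (simp add: w_def field_simps)
  \<comment> \<open>Here 1/8 <= 9/64. The first term is thus at most 3/4 of sqrt w, and the second,
    w / 2, is 1/4 of 2 w. The weights add up to 1, so the sum is at most the larger of sqrt w and 2
    w.\<close>
  also have "\<dots> \<le> sqrt ((3 / 8)\<^sup>2 * w)"
    using w by (simp add: power2_eq_square)
  also have "\<dots> = 3 / 8 * sqrt w"
    by (simp add: real_sqrt_mult)
  finally have 1: "2 * sqrt (real S / (2 * (real p - real S)) * (u / (4 * real n))) \<le> 3 / 4 * sqrt w"
    by simp
  have 2: "2 * (real S / (real p - real S)) * (u / (4 * real n)) = w / 2"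
    using assms by (simp add: w_def field_simps)
  have 3: "MS_threshold n p S u = max (sqrt w) (2 * w)"
    by (simp add: MS_threshold_def w_def mult.assoc)
  have "3 / 4 * sqrt w + w / 2 \<le> max (sqrt w) (2 * w)"
    by (simp add: max_def)
  with 1 show ?thesis
    unfolding 2 3 by (rule order_trans[OF add_right_mono])
qed

lemma MS_test_eq_of_bool:
  fixes X :: "nat \<Rightarrow> real^'p::{finite,wellorder}"
  assumes "1 \<le> n"
  shows "MS_test n S u X = of_bool (real n * MS_threshold n CARD('p) S u
    \<le> (\<Sum>k = 1..n. X k \<bullet> ((A_upto S :: real^'p::_^'p::_) *v X k)))"
proof -
  have "(A_upto S :: real^'p::_^'p::_) $ i $ i = 0" for i
    by (simp add: A_upto_nth lag_weight_def lag_def)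
  from phi_sample_cov[OF this, of n X] show ?thesis
    unfolding MS_test_def using assms by (simp only: pos_le_divide_eq of_nat_0_less_iff mult.commute)
qed

lemma MS_test_type_I_error:
  fixes n S :: nat and u :: real
  assumes n: "1 \<le> n" and S: "1 \<le> S" "S < CARD('p::{finite,wellorder})" and u: "0 < u"
  defines "N \<equiv> sample_law n (mat 1 :: real^'p::_^'p::_)"
  shows "measure N {X \<in> space N. MS_test n S u X = 1} \<le> exp (- u / 4)"
proof -
  let ?A = "A_upto S :: real^'p::_^'p::_" and ?p = "real CARD('p)"
  let ?t = "MS_threshold n CARD('p) S u"
  have tr: "trace (?A ** mat 1) = 0"
    by (simp add: trace_def A_upto_nth lag_weight_def lag_def)
  have "measure N {X \<in> space N. MS_test n S u X = 1} \<le> exp (- (real n * (u / (4 * real n))))"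
    unfolding N_def
  proof (rule quadratic_form_tail[OF mat_1_spd transpose_A_upto _ A_upto_quadratic_form_le[OF S(2)]
        norm_A_upto_le[OF S(2)], where K = 1])
    fix X :: "nat \<Rightarrow> real^'p::_"
    assume "X \<in> {X \<in> space (sample_law n (mat 1)). MS_test n S u X = 1}"
    then have "real n * ?t \<le> (\<Sum>k = 1..n. X k \<bullet> (?A *v X k))"
      unfolding MS_test_eq_of_bool[OF n] of_bool_eq_1_iff by blast
    moreover have "real n * (2 * sqrt (real S / (2 * (?p - real S)) * (u / (4 * real n)))
        + 2 * (real S / (?p - real S)) * (u / (4 * real n))) \<le> real n * ?t"
      by (intro mult_left_mono deviation_le_MS_threshold n S u) simp
    ultimately show "real n * (trace (?A ** mat 1)
        + 1 * (2 * sqrt (real S / (2 * (?p - real S)) * (u / (4 * real n)))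
          + 2 * (real S / (?p - real S)) * (u / (4 * real n))))
      \<le> (\<Sum>k = 1..n. X k \<bullet> (?A *v X k))"
      unfolding tr add_0_left mult_1_left by (rule order_trans[rotated])
  qed (use S u n in auto)
  then show ?thesis
    using n by simp
qed

text \<open>The claim amounts to 2 t <= m (1 - 2 t). The separation gives 2 (s + 1) t <= s \<sigma>
  <= m, and \<sigma> < 1 turns it into (s + 1) (1 - 2 t) >= 1. Multiplying the latter by m and
  cancelling s + 1 yields the claim.\<close>

lemma separation_beats_deviation:
  fixes s :: nat and t m \<sigma> :: real
  assumes "1 \<le> s" "0 \<le> t" "2 * (real s + 1) / real s * t \<le> \<sigma>" "\<sigma> < 1" "real s * \<sigma> \<le> m"
  shows "(1 + 2 * m) * t \<le> m - t"
proof -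
  have s: "real s > 0" using assms by simp
  have \<sigma>: "2 * (real s + 1) * t \<le> real s * \<sigma>"
    using assms(3) s by (simp add: field_simps)
  then have m: "2 * (real s + 1) * t \<le> m"
    using assms(5) by linarith
  have "real s * \<sigma> \<le> real s"
    using assms(4) s by simp
  then have "1 \<le> (real s + 1) * (1 - 2 * t)"
    using \<sigma> by (simp add: algebra_simps)
  moreover have "0 \<le> m"
    using m assms(2) s by (smt (verit) mult_nonneg_nonneg)
  ultimately have "m \<le> m * ((real s + 1) * (1 - 2 * t))"
    using mult_left_mono[of 1 "(real s + 1) * (1 - 2 * t)" m] by simp
  with m have "(real s + 1) * (2 * t) \<le> (real s + 1) * (m * (1 - 2 * t))"
    by (simp add: mult_ac)
  then have "2 * t \<le> m * (1 - 2 * t)"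
    using s by (simp add: mult_le_cancel_left)
  then show ?thesis
    by (simp add: algebra_simps)
qed

lemma MS_test_type_II_error:
  fixes n s S :: nat and u \<sigma> :: real and \<Sigma> :: "real^'p::{finite,wellorder}^'p::_"
  assumes n: "1 \<le> n" and s: "1 \<le> s" and S: "1 \<le> S" "S < CARD('p)" and u: "0 < u" and \<sigma>: "0 < \<sigma>"
    and sep: "2 * (real s + 1) / real s * MS_threshold n CARD('p) S u \<le> \<sigma>"
    and \<Sigma>: "\<Sigma> \<in> F_plus s S \<sigma>"
  shows "measure (sample_law n \<Sigma>) {X \<in> space (sample_law n \<Sigma>). MS_test n S u X = 0} \<le> exp (- u / 4)"
proof -
  let ?A = "A_upto S :: real^'p::_^'p::_" and ?p = "real CARD('p)"
  let ?t = "MS_threshold n CARD('p) S u"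
  obtain c J where spd: "\<Sigma> \<in> spd_matrices" and c: "\<And>i j. \<Sigma> $ i $ j = c (lag i j)" and c0: "c 0 = 1"
    and J: "J \<subseteq> {1..S}" "card J = s" "\<And>j. j \<in> J \<Longrightarrow> \<sigma> \<le> c j"
    and cJ: "\<And>j. j \<in> {1..CARD('p) - 1} - J \<Longrightarrow> c j = 0"
    using \<Sigma> unfolding F_plus_def by auto
  have JS: "J \<subseteq> {1..CARD('p) - 1}"
    using J(1) S(2) by (force simp: subset_iff)
  define m where "m = (\<Sum>j = 1..S. c j)"
  have mJ: "m = (\<Sum>j\<in>J. c j)"
    unfolding m_def using J(1) S cJ by (intro sum.mono_neutral_right) auto
  \<comment> \<open>On J the correlations are at least \<sigma> > 0 and elsewhere they vanish, so
    absolute values change nothing. Hence the mean m also controls the row sums of \<Sigma>.\<close>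
  have m': "(\<Sum>j = 1..CARD('p) - 1. \<bar>c j\<bar>) = m"
  proof -
    have "(\<Sum>j = 1..CARD('p) - 1. \<bar>c j\<bar>) = (\<Sum>j\<in>J. \<bar>c j\<bar>)"
      using JS cJ by (intro sum.mono_neutral_right) auto
    also have "\<dots> = (\<Sum>j\<in>J. c j)"
      using J(3) \<sigma> by (intro sum.cong) force+
    finally show ?thesis by (simp add: mJ)
  qed
  have sm: "real s * \<sigma> \<le> m"
    unfolding mJ using sum_mono[of J "\<lambda>_. \<sigma>" c] J by simp
  \<comment> \<open>Some lag in J is needed to compare \<sigma> with a correlation, which positive
    definiteness keeps below 1.\<close>
  have "J \<noteq> {}" using J(2) s by auto
  then obtain j where j: "j \<in> J" by blast
  then have "c j < 1"
    using spd_toeplitz_offdiag_less_1[OF spd c, of j] JS c0 by auto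
  with J(3)[OF j] have "\<sigma> < 1" by simp
  have "0 \<le> ?t"
    using S u by (auto simp: MS_threshold_def le_max_iff_disj)
  then have beats: "(1 + 2 * m) * ?t \<le> m - ?t"
    using separation_beats_deviation[OF s _ sep \<open>\<sigma> < 1\<close> sm] by simp
  have m0: "0 \<le> m"
    using sm \<sigma> by (smt (verit) mult_nonneg_nonneg of_nat_0_le_iff)
  have tr: "trace (- ?A ** \<Sigma>) = - m"
    using trace_A_upto_mult[OF S(2) c]
    by (simp add: trace_def matrix_matrix_mult_def m_def sum_negf)
  have sym: "transpose \<Sigma> = \<Sigma>"
    using spd by (simp add: spd_matrices_def)
  have Kabs: "\<bar>x \<bullet> (\<Sigma> *v x)\<bar> \<le> (1 + 2 * m) * (x \<bullet> x)" for x
  proof (rule symmetric_quadratic_form_le_row_sum[OF sym])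
    show "(\<Sum>l\<in>UNIV. \<bar>\<Sigma> $ k $ l\<bar>) \<le> 1 + 2 * m" for k
      using sum_lag_le[of "\<lambda>j. \<bar>c j\<bar>" k] unfolding m' by (simp add: c c0)
  qed
  have negA: "- ?A *v x = - (?A *v x)" for x
    by (simp add: matrix_vector_mult_def vec_eq_iff sum_negf)
  have "measure (sample_law n \<Sigma>) {X \<in> space (sample_law n \<Sigma>). MS_test n S u X = 0}
      \<le> exp (- (real n * (u / (4 * real n))))"
  proof (rule quadratic_form_tail[OF spd, of "- ?A" "1 + 2 * m" "real S / (?p - real S)"
        "real S / (2 * (?p - real S))"])
    show "transpose (- ?A) = - ?A"
      using transpose_A_upto[of S] by (simp add: transpose_def vec_eq_iff)
    show "x \<bullet> (\<Sigma> *v x) \<le> (1 + 2 * m) * (x \<bullet> x)" for x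
      using Kabs[of x] by simp
    show "\<bar>x \<bullet> (- ?A *v x)\<bar> \<le> real S / (?p - real S) * (x \<bullet> x)" for x
      using A_upto_quadratic_form_le[OF S(2), of x] by (simp add: negA)
    fix X :: "nat \<Rightarrow> real^'p::_"
    assume "X \<in> {X \<in> space (sample_law n \<Sigma>). MS_test n S u X = 0}"
    then have "\<not> real n * ?t \<le> (\<Sum>k = 1..n. X k \<bullet> (?A *v X k))"
      unfolding MS_test_eq_of_bool[OF n] of_bool_eq_0_iff by blast
    \<comment> \<open>Acceptance is a strict lower-tail event. With the sign reversed it is weakened
      to the upper-tail form required for the matrix - A.\<close>
    then have X: "real n * - ?t \<le> (\<Sum>k = 1..n. X k \<bullet> (- ?A *v X k))"
      by (simp add: negA sum_negf)
    define D where "D = 2 * sqrt (real S / (2 * (?p - real S)) * (u / (4 * real n)))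
        + 2 * (real S / (?p - real S)) * (u / (4 * real n))"
    have "D \<le> ?t"
      unfolding D_def by (intro deviation_le_MS_threshold n S u)
    then have "(1 + 2 * m) * D \<le> (1 + 2 * m) * ?t"
      using m0 by (intro mult_left_mono) simp_all
    with beats have "trace (- ?A ** \<Sigma>) + (1 + 2 * m) * D \<le> - ?t"
      unfolding tr by linarith
    from order_trans[OF mult_left_mono[OF this] X]
    show "real n * (trace (- ?A ** \<Sigma>)
        + (1 + 2 * m) * (2 * sqrt (real S / (2 * (?p - real S)) * (u / (4 * real n)))
          + 2 * (real S / (?p - real S)) * (u / (4 * real n))))
      \<le> (\<Sum>k = 1..n. X k \<bullet> (- ?A *v X k))"
      unfolding D_def by simp
  qed (use S u n m0 norm_A_upto_le[OF S(2)] in simp_all)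
  then show ?thesis
    using n by simp
qed

theorem theorem3p1:
  fixes n s S :: nat and u \<sigma> :: real
  assumes "1 \<le> n"
    and "1 \<le> s" and "s \<le> S" and "real S < real CARD('p::{finite,wellorder}) / 2"
    and "0 < u" and "0 < \<sigma>"
    and "2 * (real s + 1) / real s * MS_threshold n CARD('p) S u \<le> \<sigma>"
  shows "risk n (MS_test n S u) (F_plus s S \<sigma> :: (real^'p::_^'p::_) set) \<le> 2 * exp (- u / 4)"
proof -
  have S: "1 \<le> S" "S < CARD('p)"
    using assms by simp_all
  \<comment> \<open>The bound for each alternative passes to the supremum. The inserted 0 keeps the
    set nonempty and lies below the exponential.\<close>
  have "Sup (insert 0 ((\<lambda>\<Sigma>. measure (sample_law n \<Sigma>)
      {X \<in> space (sample_law n \<Sigma>). MS_test n S u X = 0}) ` (F_plus s S \<sigma> :: (real^'p::_^'p::_) set)))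
    \<le> exp (- u / 4)"
    using MS_test_type_II_error[OF assms(1,2) S assms(5-7)] by (intro cSup_least) auto
  with MS_test_type_I_error[OF assms(1) S assms(5)] show ?thesis
    unfolding risk_def by simp
qed

end
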